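(* For every integer $t\geq 8$ the following holds. For arbitrarily small $\epsilon>0$ there exists a graph property $\Pi=\Pi_\epsilon$ (which depends on $\epsilon$) such that, if $q$ denotes the adaptive query complexity and $Q$ the non-adaptive query complexity of $\epsilon$-testing $\Pi$ in the dense-graph model, then $q=\tilde{\Theta}(\epsilon^{-1})$ and $Q=\tilde{\Theta}(q^{2-2/t})$.
   Context: Dense-graph model: an algorithm receives $N$ and $\epsilon$ and accesses an undirected graph $G=([N],E)$ only through an oracle $g:[N]\times[N]\to\{0,1\}$ with $g(u,v)=1$ iff $(u,v)\in E$; each oracle call is a query. A graph is $\epsilon$-far from a property (set of graphs closed under isomorphism) $\Pi$ if at least $\epsilon N^2$ edges must be added or deleted to obtain a graph in $\Pi$, and $\epsilon$-close otherwise. A randomized algorithm is an $\epsilon$-tester for $\Pi$ if it accepts every $G\in\Pi$ with probability $>2/3$ and rejects every $G$ that is $\epsilon$-far from $\Pi$ with probability $>2/3$. A tester is adaptive if each query may depend on answers to previous queries, and non-adaptive if all queries are fixed in advance (depending only on internal randomness). The (adaptive, resp. non-adaptive) query complexity is the minimum, over all (adaptive, resp. non-adaptive) $\epsilon$-testers, of the maximal number of queries made, as a function of $\epsilon$. The notation $\tilde{\Theta}$ hides factors polylogarithmic in $1/\epsilon$ and constants depending on $t$, with asymptotics as $\epsilon\to 0$. *)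

theory Defs
  imports "HOL-Probability.Probability_Mass_Function" "HOL-Library.Extended_Nat"
begin

definition is_graph :: "nat \<Rightarrow> (nat \<Rightarrow> nat \<Rightarrow> bool) \<Rightarrow> bool" where
  "is_graph N E \<longleftrightarrow> (\<forall>u v. E u v \<longrightarrow> u < N \<and> v < N) \<and> (\<forall>u v. E u v = E v u) \<and> (\<forall>u. \<not> E u u)"

definition relabel :: "nat \<Rightarrow> (nat \<Rightarrow> nat) \<Rightarrow> (nat \<Rightarrow> nat \<Rightarrow> bool) \<Rightarrow> (nat \<Rightarrow> nat \<Rightarrow> bool)" where
  "relabel N \<sigma> E = (\<lambda>u v. u < N \<and> v < N \<and> E (\<sigma> u) (\<sigma> v))"

definition graph_property :: "(nat \<times> (nat \<Rightarrow> nat \<Rightarrow> bool)) set \<Rightarrow> bool" where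
  "graph_property P \<longleftrightarrow> (\<forall>N E. (N, E) \<in> P \<longrightarrow> is_graph N E) \<and>
     (\<forall>N E \<sigma>. (N, E) \<in> P \<longrightarrow> bij_betw \<sigma> {0..<N} {0..<N} \<longrightarrow> (N, relabel N \<sigma> E) \<in> P)"

definition graph_dist :: "nat \<Rightarrow> (nat \<Rightarrow> nat \<Rightarrow> bool) \<Rightarrow> (nat \<Rightarrow> nat \<Rightarrow> bool) \<Rightarrow> nat" where
  "graph_dist N E F = card {(u, v). u < v \<and> v < N \<and> E u v \<noteq> F u v}"

definition eps_far :: "real \<Rightarrow> (nat \<times> (nat \<Rightarrow> nat \<Rightarrow> bool)) set \<Rightarrow> nat \<Rightarrow> (nat \<Rightarrow> nat \<Rightarrow> bool) \<Rightarrow> bool" where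
  "eps_far \<epsilon> P N E \<longleftrightarrow> (\<forall>F. (N, F) \<in> P \<longrightarrow> real (graph_dist N E F) \<ge> \<epsilon> * real N ^ 2)"

text \<open>Deterministic adaptive query algorithms = decision trees. A node Query u v l r
  queries g(u,v) and continues with l if the answer is 0 and with r if it is 1;
  a leaf outputs accept (True) or reject (False).\<close>
datatype dtree = Leaf bool | Query nat nat dtree dtree

fun run_tree :: "dtree \<Rightarrow> (nat \<Rightarrow> nat \<Rightarrow> bool) \<Rightarrow> bool" where
  "run_tree (Leaf b) E = b"
| "run_tree (Query u v l r) E = run_tree (if E u v then r else l) E"

fun queries_made :: "dtree \<Rightarrow> (nat \<Rightarrow> nat \<Rightarrow> bool) \<Rightarrow> nat" where
  "queries_made (Leaf b) E = 0"
| "queries_made (Query u v l r) E = Suc (queries_made (if E u v then r else l) E)"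

text \<open>Non-adaptive deterministic algorithm: a fixed list of queries and a decision
  function on the list of answers, viewed as a decision tree.\<close>
fun na_tree :: "(nat \<times> nat) list \<Rightarrow> (bool list \<Rightarrow> bool) \<Rightarrow> dtree" where
  "na_tree [] d = Leaf (d [])"
| "na_tree ((u, v) # qs) d =
     Query u v (na_tree qs (\<lambda>as. d (False # as))) (na_tree qs (\<lambda>as. d (True # as)))"

text \<open>A randomized algorithm (for fixed epsilon) maps N to a distribution over
  deterministic decision trees (internal randomness).\<close>
type_synonym algorithm = "nat \<Rightarrow> dtree pmf"

definition accept_prob :: "algorithm \<Rightarrow> nat \<Rightarrow> (nat \<Rightarrow> nat \<Rightarrow> bool) \<Rightarrow> real" where
  "accept_prob T N E = measure_pmf.prob (T N) {t. run_tree t E}"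

definition is_tester :: "real \<Rightarrow> (nat \<times> (nat \<Rightarrow> nat \<Rightarrow> bool)) set \<Rightarrow> algorithm \<Rightarrow> bool" where
  "is_tester \<epsilon> P T \<longleftrightarrow> (\<forall>N E. is_graph N E \<longrightarrow>
      ((N, E) \<in> P \<longrightarrow> accept_prob T N E > 2/3) \<and>
      (eps_far \<epsilon> P N E \<longrightarrow> 1 - accept_prob T N E > 2/3))"

definition non_adaptive :: "algorithm \<Rightarrow> bool" where
  "non_adaptive T \<longleftrightarrow> (\<forall>N. \<forall>t \<in> set_pmf (T N). \<exists>qs d. t = na_tree qs d)"

definition max_queries_le :: "algorithm \<Rightarrow> nat \<Rightarrow> bool" where
  "max_queries_le T k \<longleftrightarrow> (\<forall>N E. is_graph N E \<longrightarrow> (\<forall>t \<in> set_pmf (T N). queries_made t E \<le> k))"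

text \<open>Adaptive / non-adaptive query complexity (infinity if no tester with
  a uniform-in-N query bound exists).\<close>
definition adaptive_qc :: "real \<Rightarrow> (nat \<times> (nat \<Rightarrow> nat \<Rightarrow> bool)) set \<Rightarrow> enat" where
  "adaptive_qc \<epsilon> P = Inf {enat k | k. \<exists>T. is_tester \<epsilon> P T \<and> max_queries_le T k}"

definition nonadaptive_qc :: "real \<Rightarrow> (nat \<times> (nat \<Rightarrow> nat \<Rightarrow> bool)) set \<Rightarrow> enat" where
  "nonadaptive_qc \<epsilon> P = Inf {enat k | k. \<exists>T. is_tester \<epsilon> P T \<and> non_adaptive T \<and> max_queries_le T k}"

end

theory Submission
  imports Defs
begin

text \<open>The property consists of graphs on one fixed number \<open>N\<close> of vertices all of whose balls of radius
  \<open>L \<approx> log N\<close> have at most \<open>L\<close> vertices. Every graph contains at least as many edges that start at the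
  centre of a large ball as its distance from the property; an adaptive tester samples \<open>O(1 / \<epsilon>)\<close> pairs
  and explores the balls around the edges it finds, which costs \<open>O(N)\<close> queries per edge up to
  logarithmic factors.

  The hard instances consist of \<open>d = \<epsilon> N\<^sup>2\<close> randomly placed blocks and isolated vertices. Each block is
  a pair of \<open>L\<close>-cycles or a single \<open>2 L\<close>-cycle, according to the parity of \<open>L\<close> bits hidden at consecutive
  positions. Telling such a graph from the empty one needs \<open>N\<^sup>2 / d\<close> queries, up to logarithmic
  factors. A non-adaptive algorithm learns a parity only if its queries touch every position of some
  block; with fewer than about \<open>(N / L)\<^sup>2\<close> queries this has probability exponentially small in \<open>L\<close>.
  Choosing \<open>d\<close> close to \<open>N powr (1 - 1 / (t - 1))\<close> balances the two complexities as claimed.\<close>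

section \<open>Graphs with small balls\<close>

text \<open>Closed neighbourhood, so that \<open>(grow E ^^ k) {u}\<close> is the ball of radius
  \<open>k\<close> around \<open>u\<close>.\<close>

definition grow :: "(nat \<Rightarrow> nat \<Rightarrow> bool) \<Rightarrow> nat set \<Rightarrow> nat set" where
  "grow E A = A \<union> {w. \<exists>v\<in>A. E v w}"

text \<open>\<open>L\<close> is both radius and size bound: a cycle of length \<open>L\<close> just
  meets the bound, one of length \<open>2 * L\<close> breaks it. On vertex numbers other than
  \<open>N\<close> every graph is vacuously far, so testers have to reject there.\<close>

definition small_balls :: "nat \<Rightarrow> nat \<Rightarrow> (nat \<times> (nat \<Rightarrow> nat \<Rightarrow> bool)) set" where
  "small_balls N L = {(M, E). M = N \<and> is_graph N E \<and> (\<forall>u<N. card ((grow E ^^ L) {u}) \<le> L)}"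

lemma mem_grow: "w \<in> grow E A \<longleftrightarrow> w \<in> A \<or> (\<exists>v\<in>A. E v w)"
  by (auto simp: grow_def)

lemma grow_funpow_superset: "A \<subseteq> (grow E ^^ k) A"
  by (induction k) (auto simp: mem_grow)

lemma grow_funpow_mono_steps: "k \<le> l \<Longrightarrow> (grow E ^^ k) A \<subseteq> (grow E ^^ l) A"
  by (induction l) (auto simp: mem_grow le_Suc_eq)

lemma grow_funpow_mono:
  assumes "\<And>u v. F u v \<Longrightarrow> E u v"
  shows "(grow F ^^ k) A \<subseteq> (grow E ^^ k) A"
proof (induction k)
  case (Suc k)
  then have "grow F ((grow F ^^ k) A) \<subseteq> grow E ((grow E ^^ k) A)"
    using assms unfolding grow_def by blast
  then show ?case by simp
qed simp

text \<open>Balls are bounded from above by a set closed under adjacency, such as an isolated vertex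
  or the vertex set of a cycle.\<close>

lemma grow_funpow_closed:
  assumes "A \<subseteq> C" "\<And>v w. v \<in> C \<Longrightarrow> E v w \<Longrightarrow> w \<in> C"
  shows "(grow E ^^ k) A \<subseteq> C"
proof (induction k)
  case (Suc k)
  then have "grow E ((grow E ^^ k) A) \<subseteq> C"
    using assms unfolding grow_def by blast
  then show ?case by simp
qed (use assms in simp)

lemma is_graph_less: "is_graph N E \<Longrightarrow> E u v \<Longrightarrow> u < N \<and> v < N"
  unfolding is_graph_def by blast

lemma is_graph_sym: "is_graph N E \<Longrightarrow> E u v \<Longrightarrow> E v u"
  unfolding is_graph_def by blast

lemma grow_funpow_bounded:
  assumes "is_graph N E" "A \<subseteq> {..<N}"
  shows "(grow E ^^ k) A \<subseteq> {..<N}"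
  using grow_funpow_closed[of A "{..<N}" E] assms is_graph_less by fastforce

lemma finite_ball:
  assumes "is_graph N E" "A \<subseteq> {..<N}"
  shows "finite ((grow E ^^ k) A)"
  using grow_funpow_bounded[OF assms] finite_subset by blast

text \<open>One inclusion is enough: with injectivity of \<open>\<sigma>\<close> it already bounds
  the size of the relabelled ball.\<close>

lemma ball_relabel:
  assumes "bij_betw \<sigma> {0..<N} {0..<N}" "u < N" "v \<in> (grow (relabel N \<sigma> E) ^^ k) {u}"
  shows "v < N \<and> \<sigma> v \<in> (grow E ^^ k) {\<sigma> u}"
  using assms(3)
proof (induction k arbitrary: v)
  case 0
  then show ?case using assms(2) by simp
next
  case (Suc k)
  from Suc.prems consider "v \<in> (grow (relabel N \<sigma> E) ^^ k) {u}"
    | w where "w \<in> (grow (relabel N \<sigma> E) ^^ k) {u}" "relabel N \<sigma> E w v"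
    by (auto simp: mem_grow)
  then show ?case
  proof cases
    case 1
    then show ?thesis using Suc.IH by (simp add: mem_grow)
  next
    case 2
    then show ?thesis using Suc.IH[of w] by (auto simp: mem_grow relabel_def)
  qed
qed

lemma graph_property_small_balls: "graph_property (small_balls N L)"
proof -
  have "(N, relabel N \<sigma> E) \<in> small_balls N L"
    if E: "(N, E) \<in> small_balls N L" and \<sigma>: "bij_betw \<sigma> {0..<N} {0..<N}" for E \<sigma>
  proof -
    have g: "is_graph N E" using E by (simp add: small_balls_def)
    have "is_graph N (relabel N \<sigma> E)"
      using g unfolding is_graph_def relabel_def by blast
    moreover have "card ((grow (relabel N \<sigma> E) ^^ L) {u}) \<le> L" if u: "u < N" for u
    proof -
      let ?B = "(grow (relabel N \<sigma> E) ^^ L) {u}"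
      have *: "v < N \<and> \<sigma> v \<in> (grow E ^^ L) {\<sigma> u}" if "v \<in> ?B" for v
        using ball_relabel[OF \<sigma> u that] .
      have su: "\<sigma> u < N" using \<sigma> u bij_betwE by fastforce
      have "inj_on \<sigma> ?B"
        using * by (intro inj_on_subset[OF bij_betw_imp_inj_on[OF \<sigma>]]) auto
      then have "card ?B = card (\<sigma> ` ?B)" by (simp add: card_image)
      also have "\<dots> \<le> card ((grow E ^^ L) {\<sigma> u})"
        using * su by (intro card_mono finite_ball[OF g]) auto
      also have "\<dots> \<le> L" using E su by (simp add: small_balls_def)
      finally show ?thesis .
    qed
    ultimately show ?thesis by (simp add: small_balls_def)
  qed
  then show ?thesis unfolding graph_property_def by (auto simp: small_balls_def)
qed

section \<open>Testers\<close>

fun ask :: "(nat \<times> nat) list \<Rightarrow> (bool list \<Rightarrow> dtree) \<Rightarrow> dtree" where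
  "ask [] k = k []"
| "ask ((u, v) # qs) k =
     Query u v (ask qs (\<lambda>as. k (False # as))) (ask qs (\<lambda>as. k (True # as)))"

lemma run_ask: "run_tree (ask qs k) E = run_tree (k (map (case_prod E) qs)) E"
  by (induction qs k rule: ask.induct) auto

lemma queries_ask:
  "queries_made (ask qs k) E = length qs + queries_made (k (map (case_prod E) qs)) E"
  by (induction qs k rule: ask.induct) auto

lemma na_tree_eq_ask: "na_tree qs f = ask qs (\<lambda>as. Leaf (f as))"
  by (induction qs f rule: na_tree.induct) auto

lemma run_na_tree: "run_tree (na_tree qs f) E = f (map (case_prod E) qs)"
  by (simp add: na_tree_eq_ask run_ask)

lemma queries_na_tree: "queries_made (na_tree qs f) E = length qs"
  by (simp add: na_tree_eq_ask queries_ask)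

text \<open>Breadth-first search for \<open>i\<close> rounds. Rejecting as soon as \<open>A\<close>
  exceeds \<open>L\<close> keeps every round within \<open>L * N\<close> queries, whatever the
  graph.\<close>

fun explore :: "nat \<Rightarrow> nat \<Rightarrow> nat \<Rightarrow> nat set \<Rightarrow> dtree \<Rightarrow> dtree" where
  "explore N L 0 A k = (if card A \<le> L then k else Leaf False)"
| "explore N L (Suc i) A k = (if card A \<le> L
     then (let qs = List.product (sorted_list_of_set A) [0..<N]
           in ask qs (\<lambda>as. explore N L i (A \<union> {w. \<exists>v. ((v, w), True) \<in> set (zip qs as)}) k))
     else Leaf False)"

lemma set_zip_map: "(q, b) \<in> set (zip qs (map f qs)) \<longleftrightarrow> q \<in> set qs \<and> f q = b"
  by (induction qs) auto

lemma explore_frontier: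
  assumes "is_graph N E" "A \<subseteq> {..<N}"
  defines "qs \<equiv> List.product (sorted_list_of_set A) [0..<N]"
  shows "A \<union> {w. \<exists>v. ((v, w), True) \<in> set (zip qs (map (case_prod E) qs))} = grow E A"
proof -
  have "finite A" using assms(2) finite_subset by blast
  then show ?thesis
    using is_graph_less[OF assms(1)] unfolding set_zip_map qs_def grow_def by auto
qed

text \<open>Early rejection loses nothing because balls only grow: if \<open>A\<close> is already
  too large, so is the final ball.\<close>

lemma run_explore:
  assumes "is_graph N E" "A \<subseteq> {..<N}"
  shows "run_tree (explore N L i A k) E \<longleftrightarrow> card ((grow E ^^ i) A) \<le> L \<and> run_tree k E"
  using assms(2)
proof (induction i arbitrary: A)
  case 0
  then show ?case by simp
next
  case (Suc i)
  have "card A \<le> card ((grow E ^^ Suc i) A)"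
    using Suc.prems by (intro card_mono finite_ball[OF assms(1)] grow_funpow_superset)
  moreover have "grow E A \<subseteq> {..<N}"
    using grow_funpow_bounded[OF assms(1) Suc.prems, of 1] by simp
  ultimately show ?case
    using Suc.IH[of "grow E A"] explore_frontier[OF assms(1) Suc.prems]
    by (auto simp: run_ask funpow_swap1 Let_def)
qed

lemma queries_explore:
  assumes "is_graph N E" "A \<subseteq> {..<N}"
  shows "queries_made (explore N L i A k) E \<le> i * (L * N) + queries_made k E"
  using assms(2)
proof (induction i arbitrary: A)
  case 0
  then show ?case by simp
next
  case (Suc i)
  have fin: "finite A" using Suc.prems finite_subset by blast
  have "grow E A \<subseteq> {..<N}"
    using grow_funpow_bounded[OF assms(1) Suc.prems, of 1] by simp
  note IH = Suc.IH[OF this]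
  show ?case
  proof (cases "card A \<le> L")
    case True
    have "queries_made (explore N L (Suc i) A k) E
        = card A * N + queries_made (explore N L i (grow E A) k) E"
      using explore_frontier[OF assms(1) Suc.prems] fin True
      by (simp add: queries_ask Let_def)
    also have "\<dots> \<le> L * N + (i * (L * N) + queries_made k E)"
      using IH True by (intro add_mono mult_right_mono) auto
    finally show ?thesis by simp
  qed simp
qed

fun check_balls :: "nat \<Rightarrow> nat \<Rightarrow> nat list \<Rightarrow> dtree" where
  "check_balls N L [] = Leaf True"
| "check_balls N L (u # us) = explore N L L {u} (check_balls N L us)"

lemma run_check_balls:
  assumes "is_graph N E" "set us \<subseteq> {..<N}"
  shows "run_tree (check_balls N L us) E \<longleftrightarrow> (\<forall>u\<in>set us. card ((grow E ^^ L) {u}) \<le> L)"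
  using assms(2) by (induction us) (simp_all add: run_explore[OF assms(1)])

lemma queries_check_balls:
  assumes "is_graph N E" "set us \<subseteq> {..<N}"
  shows "queries_made (check_balls N L us) E \<le> length us * (L * (L * N))"
  using assms(2)
proof (induction us)
  case (Cons u us)
  then show ?case
    using queries_explore[OF assms(1), of "{u}" L L "check_balls N L us"] by simp
qed simp

text \<open>First all pairs in \<open>ps\<close> are queried, then the balls around the first
  endpoints of the edges found are explored. The cutoff \<open>K\<close> makes the query bound hold
  in the worst case and not only on average.\<close>

definition sample_tree :: "nat \<Rightarrow> nat \<Rightarrow> nat \<Rightarrow> (nat \<times> nat) list \<Rightarrow> dtree" where
  "sample_tree N L K ps = ask ps (\<lambda>as.
     let us = map (\<lambda>x. fst (fst x)) (filter snd (zip ps as))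
     in if length us \<le> K then check_balls N L us else Leaf False)"

lemma filter_zip_map:
  "map (\<lambda>x. fst (fst x)) (filter snd (zip ps (map f ps))) = map fst (filter f ps)"
  by (induction ps) auto

lemma length_filter_zip_map: "length (filter snd (zip ps (map f ps))) = length (filter f ps)"
  by (induction ps) auto

lemma run_sample_tree:
  assumes "is_graph N E"
  shows "run_tree (sample_tree N L K ps) E \<longleftrightarrow> length (filter (case_prod E) ps) \<le> K \<and>
    (\<forall>(u, v)\<in>set ps. E u v \<longrightarrow> card ((grow E ^^ L) {u}) \<le> L)"
proof -
  have "set (map fst (filter (case_prod E) ps)) \<subseteq> {..<N}"
    using is_graph_less[OF assms] by auto
  from run_check_balls[OF assms this] show ?thesis
    by (auto simp: sample_tree_def run_ask filter_zip_map length_filter_zip_map Let_def)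
qed

lemma queries_sample_tree:
  assumes "is_graph N E"
  shows "queries_made (sample_tree N L K ps) E \<le> length ps + K * (L * (L * N))"
proof -
  have "set (map fst (filter (case_prod E) ps)) \<subseteq> {..<N}"
    using is_graph_less[OF assms] by auto
  from queries_check_balls[OF assms this, of L] show ?thesis
    by (auto simp: sample_tree_def queries_ask filter_zip_map length_filter_zip_map Let_def
        intro: order_trans[OF _ mult_right_mono])
qed

section \<open>Counting over sample lists\<close>

lemma sum_length_filter_lists:
  fixes A :: "'a set"
  assumes "finite A" "B \<subseteq> A"
  shows "card A * (\<Sum>ps | set ps \<subseteq> A \<and> length ps = m. length (filter (\<lambda>x. x \<in> B) ps))
    = m * card B * card A ^ m"
proof (induction m)
  case 0
  then show ?case by simp
next
  case (Suc m)
  let ?S = "\<lambda>m. {ps. set ps \<subseteq> A \<and> length ps = m}"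
  let ?f = "\<lambda>ps. length (filter (\<lambda>x. x \<in> B) ps)"
  have fin: "finite (?S m)" using assms(1) by (rule finite_lists_length_eq)
  have eq: "?S (Suc m) = (\<lambda>(x, ps). x # ps) ` (A \<times> ?S m)"
    by (auto simp: length_Suc_conv image_iff)
  have inj: "inj_on (\<lambda>(x, ps). x # ps) (A \<times> ?S m)"
    by (auto simp: inj_on_def)
  have "sum ?f (?S (Suc m)) = (\<Sum>(x, ps)\<in>A \<times> ?S m. ?f (x # ps))"
    unfolding eq by (subst sum.reindex[OF inj]) (simp add: case_prod_unfold comp_def)
  also have "\<dots> = (\<Sum>x\<in>A. \<Sum>ps\<in>?S m. (if x \<in> B then 1 else 0) + ?f ps)"
    unfolding sum.cartesian_product[symmetric] by (intro sum.cong) auto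
  also have "\<dots> = (\<Sum>x\<in>A. if x \<in> B then 1 else 0) * card (?S m) + card A * sum ?f (?S m)"
    by (simp add: sum.distrib sum_distrib_right mult.commute)
  also have "(\<Sum>x\<in>A. if x \<in> B then 1 else 0) = card B"
    using assms by (simp add: sum.If_cases Int_absorb1)
  also have "card (?S m) = card A ^ m" using assms(1) by (rule card_lists_length_eq)
  finally show ?case using Suc by (simp add: algebra_simps)
qed

text \<open>Markov's inequality for the number of samples in \<open>B\<close>, in counting form: the
  preceding lemma supplies the expectation \<open>m * card B / card A\<close>, and products replace
  quotients.\<close>

lemma markov_length_filter_lists:
  fixes A :: "'a set"
  assumes "finite A" "B \<subseteq> A"
  shows "card A * ((K + 1) * card {ps. (set ps \<subseteq> A \<and> length ps = m) \<and> K < length (filter (\<lambda>x. x \<in> B) ps)})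
    \<le> m * card B * card A ^ m"
proof -
  let ?S = "{ps. set ps \<subseteq> A \<and> length ps = m}"
  let ?f = "\<lambda>ps. length (filter (\<lambda>x. x \<in> B) ps)"
  let ?X = "{ps. (set ps \<subseteq> A \<and> length ps = m) \<and> K < ?f ps}"
  have fin: "finite ?S" using assms(1) by (rule finite_lists_length_eq)
  have "(K + 1) * card ?X = (\<Sum>ps\<in>?X. K + 1)" by simp
  also have "\<dots> \<le> sum ?f ?X" by (rule sum_mono) auto
  also have "\<dots> \<le> sum ?f ?S" by (rule sum_mono2[OF fin]) auto
  finally have "(K + 1) * card ?X \<le> sum ?f ?S" .
  then have "card A * ((K + 1) * card ?X) \<le> card A * sum ?f ?S" by (rule mult_left_mono) simp
  then show ?thesis using sum_length_filter_lists[OF assms, of m] by simp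
qed

section \<open>Distance from the property and number of edges\<close>

definition bad_pairs :: "nat \<Rightarrow> nat \<Rightarrow> (nat \<Rightarrow> nat \<Rightarrow> bool) \<Rightarrow> (nat \<times> nat) set" where
  "bad_pairs N L E = {(u, v). E u v \<and> L < card ((grow E ^^ L) {u})}"

text \<open>Deleting all edges at centres of large balls isolates these centres and only shrinks the
  other balls. Each deleted edge is charged to an orientation that starts at such a centre.\<close>

lemma card_bad_pairs_ge_distance:
  assumes "is_graph N E" "1 \<le> L"
  shows "\<exists>F. (N, F) \<in> small_balls N L \<and> graph_dist N E F \<le> card (bad_pairs N L E)"
proof -
  let ?good = "\<lambda>u. card ((grow E ^^ L) {u}) \<le> L"
  define F where "F u v \<longleftrightarrow> E u v \<and> ?good u \<and> ?good v" for u v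
  have F: "is_graph N F" using assms(1) unfolding is_graph_def F_def by blast
  have "card ((grow F ^^ L) {u}) \<le> L" if u: "u < N" for u
  proof (cases "?good u")
    case True
    have "(grow F ^^ L) {u} \<subseteq> (grow E ^^ L) {u}"
      by (rule grow_funpow_mono) (simp add: F_def)
    then have "card ((grow F ^^ L) {u}) \<le> card ((grow E ^^ L) {u})"
      using u by (intro card_mono finite_ball[OF assms(1)]) auto
    then show ?thesis using True by simp
  next
    case False
    have "(grow F ^^ L) {u} \<subseteq> {u}"
      by (rule grow_funpow_closed) (use False in \<open>auto simp: F_def\<close>)
    then have "card ((grow F ^^ L) {u}) \<le> card {u}" by (intro card_mono) auto
    then show ?thesis using assms(2) by simp
  qed
  then have mem: "(N, F) \<in> small_balls N L" using F by (simp add: small_balls_def)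
  let ?D = "{(u, v). u < v \<and> v < N \<and> E u v \<noteq> F u v}"
  \<comment> \<open>Orients a deleted edge away from a bad endpoint; injective because
    \<open>u < v\<close> holds in \<open>?D\<close>.\<close>
  let ?h = "\<lambda>(u, v). if ?good u then (v, u) else (u, v)"
  have fin: "finite (bad_pairs N L E)"
    by (rule finite_subset[of _ "{..<N} \<times> {..<N}"])
       (auto simp: bad_pairs_def dest: is_graph_less[OF assms(1)])
  have "inj_on ?h ?D" by (auto simp: inj_on_def split: if_splits)
  moreover have "?h ` ?D \<subseteq> bad_pairs N L E"
    using is_graph_sym[OF assms(1)] by (auto simp: bad_pairs_def F_def not_le split: if_splits)
  ultimately have "card ?D \<le> card (bad_pairs N L E)" using fin by (intro card_inj_on_le)
  then show ?thesis using mem unfolding graph_dist_def by blast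
qed

text \<open>Since \<open>1 \<le> L\<close>, all neighbours of \<open>u\<close> lie in its ball,
  which bounds the degree by \<open>L\<close>.\<close>

lemma card_edges_small_balls:
  assumes "(N, E) \<in> small_balls N L" "1 \<le> L"
  shows "card {(u, v). E u v} \<le> N * L"
proof -
  have g: "is_graph N E" using assms(1) by (simp add: small_balls_def)
  have sub: "{(u, v). E u v} \<subseteq> (SIGMA u:{..<N}. (grow E ^^ L) {u})"
  proof clarify
    fix u v assume e: "E u v"
    then have "v \<in> (grow E ^^ 1) {u}" by (simp add: mem_grow)
    then show "u \<in> {..<N} \<and> v \<in> (grow E ^^ L) {u}"
      using grow_funpow_mono_steps[OF assms(2)] is_graph_less[OF g e] by auto
  qed
  have fin: "finite ((grow E ^^ L) {u})" if "u < N" for u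
    using finite_ball[OF g] that by auto
  have "card {(u, v). E u v} \<le> card (SIGMA u:{..<N}. (grow E ^^ L) {u})"
    using fin by (intro card_mono[OF _ sub]) auto
  also have "\<dots> = (\<Sum>u<N. card ((grow E ^^ L) {u}))" using fin by (subst card_SigmaI) auto
  also have "\<dots> \<le> (\<Sum>u<N. L)" using assms(1) by (intro sum_mono) (auto simp: small_balls_def)
  finally show ?thesis by simp
qed

lemma exp_minus_two_less: "exp (- 2 :: real) < 1 / 3"
proof -
  have "3 \<le> exp (2 :: real)" using exp_ge_add_one_self[of 2] by simp
  moreover have "exp (2::real) \<noteq> 3"
  proof
    assume "exp (2::real) = 3"
    moreover have "exp (2::real) = exp 1 * exp 1" by (simp flip: exp_add)
    moreover have "(2::real) * 2 \<le> exp 1 * exp 1"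
      using exp_ge_add_one_self[of 1] by (intro mult_mono) auto
    ultimately show False by simp
  qed
  ultimately show ?thesis by (simp add: exp_minus field_simps)
qed

text \<open>Each numerical condition keeps one kind of error below 1/3. A graph in the property has
  at most \<open>N * L\<close> ordered edges, so a sample has at most
  \<open>m * L / N \<le> K / 3\<close> edges on average. A far graph has at least \<open>d\<close>
  bad pairs, and all \<open>m\<close> samples miss them with probability at most
  \<open>exp (- 2)\<close>.\<close>

lemma adaptive_tester_small_balls:
  assumes "0 < N" "1 \<le> L" "0 < d" "d \<le> N * N"
    and m: "2 * (N * N) \<le> m * d" and K: "3 * m * L \<le> K * N"
  shows "\<exists>T. is_tester (real d / real N ^ 2) (small_balls N L) T \<and>
    max_queries_le T (m + K * (L * (L * N)))"
proof -
  let ?A = "{..<N} \<times> {..<N}"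
  let ?S = "{ps. set ps \<subseteq> ?A \<and> length ps = m}"
  let ?\<epsilon> = "real d / real N ^ 2"
  \<comment> \<open>No graph on \<open>M \<noteq> N\<close> vertices is in the property, so constant
    rejection is right there.\<close>
  define T where "T M = (if M = N then map_pmf (sample_tree N L K) (pmf_of_set ?S)
    else return_pmf (Leaf False))" for M
  have finS: "finite ?S" by (rule finite_lists_length_eq) simp
  have cardS: "card ?S = (N * N) ^ m" by (subst card_lists_length_eq) auto
  have neS: "?S \<noteq> {}"
  proof
    assume "?S = {}"
    then have "(N * N) ^ m = 0" using cardS by (metis card.empty)
    then show False using assms(1) by simp
  qed
  have acc: "accept_prob T N E
      = real (card (?S \<inter> {ps. run_tree (sample_tree N L K ps) E})) / real ((N * N) ^ m)" for E
    using measure_pmf_of_set[OF neS finS] cardS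
    by (simp add: accept_prob_def T_def vimage_def)
  have "accept_prob T N E > 2 / 3" if E: "(N, E) \<in> small_balls N L" for E
  proof -
    have g: "is_graph N E" using E by (simp add: small_balls_def)
    let ?B = "{(u, v). E u v}"
    let ?X = "{ps. (set ps \<subseteq> ?A \<and> length ps = m) \<and> K < length (filter (\<lambda>x. x \<in> ?B) ps)}"
    have B: "?B \<subseteq> ?A" using is_graph_less[OF g] by auto
    have "N * N * ((K + 1) * card ?X) \<le> m * card ?B * (N * N) ^ m"
      using markov_length_filter_lists[OF _ B, of K m] by simp
    also have "\<dots> \<le> m * (N * L) * (N * N) ^ m"
      using card_edges_small_balls[OF E assms(2)] by (intro mult_right_mono mult_left_mono) auto
    finally have "N * (N * ((K + 1) * card ?X)) \<le> N * (m * L * (N * N) ^ m)"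
      by (simp add: mult_ac)
    then have "N * ((K + 1) * card ?X) \<le> m * L * (N * N) ^ m" using assms(1) by simp
    then have "3 * (N * ((K + 1) * card ?X)) \<le> (3 * m * L) * (N * N) ^ m" by simp
    also have "\<dots> \<le> (K * N) * (N * N) ^ m" using K by (rule mult_right_mono) simp
    \<comment> \<open>Markov at threshold \<open>K + 1\<close> makes the inequality strict, as
      acceptance above 2/3 demands.\<close>
    also have "\<dots> < ((K + 1) * N) * (N * N) ^ m" using assms(1) by simp
    finally have "((K + 1) * N) * (3 * card ?X) < ((K + 1) * N) * (N * N) ^ m"
      by (simp only: mult_ac)
    then have less: "3 * card ?X < (N * N) ^ m" unfolding mult_less_cancel1 by (rule conjunct2)
    have f: "filter (\<lambda>x. x \<in> ?B) ps = filter (case_prod E) ps" for ps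
      by (rule filter_cong) auto
    have small: "card ((grow E ^^ L) {u}) \<le> L" if "E u v" for u v
      using E is_graph_less[OF g that] by (simp add: small_balls_def)
    have "?S - ?X \<subseteq> ?S \<inter> {ps. run_tree (sample_tree N L K ps) E}"
      unfolding run_sample_tree[OF g] f using small by auto
    then have "card (?S - ?X) \<le> card (?S \<inter> {ps. run_tree (sample_tree N L K ps) E})"
      using finS by (intro card_mono) auto
    moreover have "card (?S - ?X) = card ?S - card ?X"
    proof (rule card_Diff_subset)
      show sub: "?X \<subseteq> ?S" by blast
      show "finite ?X" by (rule finite_subset[OF sub finS])
    qed
    ultimately have "2 * (N * N) ^ m < 3 * card (?S \<inter> {ps. run_tree (sample_tree N L K ps) E})"
      using less cardS by linarith
    then have "2 * real ((N * N) ^ m) < 3 * real (card (?S \<inter> {ps. run_tree (sample_tree N L K ps) E}))"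
      by linarith
    moreover have "0 < real ((N * N) ^ m)" using assms(1) by simp
    ultimately show ?thesis unfolding acc by (simp only: pos_less_divide_eq)
  qed
  moreover have "1 - accept_prob T N E > 2 / 3"
    if g: "is_graph N E" and far: "eps_far ?\<epsilon> (small_balls N L) N E" for E
  proof -
    let ?B = "bad_pairs N L E"
    obtain F where F: "(N, F) \<in> small_balls N L" "graph_dist N E F \<le> card ?B"
      using card_bad_pairs_ge_distance[OF g assms(2)] by blast
    have "?\<epsilon> * real N ^ 2 \<le> real (graph_dist N E F)" using far F(1) by (simp add: eps_far_def)
    then have dB: "d \<le> card ?B" using F(2) assms(1) by simp
    have BA: "?B \<subseteq> ?A" using is_graph_less[OF g] by (auto simp: bad_pairs_def)
    have finB: "finite ?B" by (rule finite_subset[OF BA]) simp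
    \<comment> \<open>An accepted sample contains no bad pair, since the ball around its first
      endpoint would cause rejection.\<close>
    have "?S \<inter> {ps. run_tree (sample_tree N L K ps) E} \<subseteq> {ps. set ps \<subseteq> ?A - ?B \<and> length ps = m}"
      unfolding run_sample_tree[OF g] bad_pairs_def by fastforce
    then have "card (?S \<inter> {ps. run_tree (sample_tree N L K ps) E})
        \<le> card {ps. set ps \<subseteq> ?A - ?B \<and> length ps = m}"
      by (intro card_mono finite_lists_length_eq) auto
    also have "\<dots> = (N * N - card ?B) ^ m"
      using finB BA by (subst card_lists_length_eq) (auto simp: card_Diff_subset)
    also have "\<dots> \<le> (N * N - d) ^ m" using dB by (intro power_mono) auto
    finally have "real (card (?S \<inter> {ps. run_tree (sample_tree N L K ps) E})) \<le> real (N * N - d) ^ m"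
      unfolding of_nat_power[symmetric] by (rule of_nat_mono)
    then have "accept_prob T N E \<le> real (N * N - d) ^ m / real ((N * N) ^ m)"
      unfolding acc by (intro divide_right_mono) auto
    also have "\<dots> = (1 + (- (real d / real (N * N)))) ^ m"
      using assms(1,4) by (simp add: power_divide[symmetric] of_nat_diff diff_divide_distrib)
    also have "\<dots> \<le> exp (- (real d / real (N * N))) ^ m"
    proof (rule power_mono[OF exp_ge_add_one_self])
      have "real d \<le> real (N * N)" using assms(4) by (rule of_nat_mono)
      then show "0 \<le> 1 + - (real d / real (N * N))"
        using assms(1) by (simp add: divide_le_eq)
    qed
    also have "\<dots> = exp (- (real (m * d) / real (N * N)))"
      by (simp flip: exp_of_nat_mult)
    also have "\<dots> \<le> exp (- 2)"
    proof -
      have "real (2 * (N * N)) \<le> real (m * d)" using m by (rule of_nat_mono)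
      then have "2 \<le> real (m * d) / real (N * N)" using assms(1) by (simp add: le_divide_eq)
      then show ?thesis by simp
    qed
    also note exp_minus_two_less
    finally show ?thesis by simp
  qed
  moreover have "1 - accept_prob T M E > 2 / 3" if "M \<noteq> N" for M E
    using that by (simp add: accept_prob_def T_def)
  ultimately have "is_tester ?\<epsilon> (small_balls N L) T"
    unfolding is_tester_def
  proof (intro allI impI, goal_cases)
    case (1 M E)
    then show ?case by (cases "M = N") (auto simp: small_balls_def)
  qed
  moreover have "max_queries_le T (m + K * (L * (L * N)))"
    unfolding max_queries_le_def
  proof (intro allI impI ballI)
    fix M E t assume g: "is_graph M E" and t: "t \<in> set_pmf (T M)"
    show "queries_made t E \<le> m + K * (L * (L * N))"
    proof (cases "M = N")
      case True
      have "set_pmf (T N) = sample_tree N L K ` ?S"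
        using set_pmf_of_set[OF neS finS] by (simp add: T_def)
      then obtain ps where "length ps = m" "t = sample_tree N L K ps"
        using t True by blast
      then show ?thesis using queries_sample_tree[of N E L K ps] g True by simp
    next
      case False
      then show ?thesis using t by (simp add: T_def)
    qed
  qed
  ultimately show ?thesis by blast
qed

text \<open>Reading all pairs decides membership without error. A member is never far as well,
  because it has distance 0 from itself and \<open>\<epsilon>\<close> is positive.\<close>

lemma nonadaptive_tester_small_balls:
  assumes "0 < \<epsilon>" "0 < N"
  shows "\<exists>T. is_tester \<epsilon> (small_balls N L) T \<and> non_adaptive T \<and> max_queries_le T (N * N)"
proof -
  define qs where "qs = List.product [0..<N] [0..<N]"
  define f where "f as \<longleftrightarrow> (N, \<lambda>u v. ((u, v), True) \<in> set (zip qs as)) \<in> small_balls N L" for as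
  define T where "T M = return_pmf (if M = N then na_tree qs f else na_tree [] (\<lambda>_. False))" for M
  have run: "run_tree (na_tree qs f) E \<longleftrightarrow> (N, E) \<in> small_balls N L" if g: "is_graph N E" for E
  proof -
    have "(\<lambda>u v. ((u, v), True) \<in> set (zip qs (map (case_prod E) qs))) = E"
      using is_graph_less[OF g] by (auto simp: fun_eq_iff set_zip_map qs_def)
    then show ?thesis by (simp add: run_na_tree f_def)
  qed
  have notfar: "\<not> eps_far \<epsilon> (small_balls N L) N E" if "(N, E) \<in> small_balls N L" for E
  proof
    assume "eps_far \<epsilon> (small_balls N L) N E"
    then have "\<epsilon> * real N ^ 2 \<le> real (graph_dist N E E)" using that by (simp add: eps_far_def)
    moreover have "0 < \<epsilon> * real N ^ 2" using assms by simp
    ultimately show False by (simp add: graph_dist_def)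
  qed
  have "is_tester \<epsilon> (small_balls N L) T"
    unfolding is_tester_def
  proof (intro allI impI)
    fix M E assume g: "is_graph M E"
    show "((M, E) \<in> small_balls N L \<longrightarrow> accept_prob T M E > 2/3) \<and>
      (eps_far \<epsilon> (small_balls N L) M E \<longrightarrow> 1 - accept_prob T M E > 2/3)"
    proof (cases "M = N")
      case True
      then show ?thesis using g run[of E] notfar[of E]
        by (cases "(N, E) \<in> small_balls N L") (auto simp: accept_prob_def T_def)
    next
      case False
      then show ?thesis by (auto simp: accept_prob_def T_def small_balls_def)
    qed
  qed
  moreover have "non_adaptive T" unfolding non_adaptive_def T_def
    by (intro allI ballI) (metis set_return_pmf singletonD)
  moreover have "max_queries_le T (N * N)"
    by (auto simp: max_queries_le_def T_def queries_na_tree qs_def simp del: na_tree.simps)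
  ultimately show ?thesis by blast
qed

section \<open>Twisted cycles\<close>

text \<open>Parity of the crossings of block \<open>j\<close> at positions below
  \<open>i\<close>.\<close>

fun twist :: "(nat \<times> nat) set \<Rightarrow> nat \<Rightarrow> nat \<Rightarrow> bool" where
  "twist x j 0 = False"
| "twist x j (Suc i) = (twist x j i \<noteq> ((j, i) \<in> x))"

text \<open>Toggles one position in each of the \<open>d\<close> blocks at once, so that all
  parities change together.\<close>

definition flip :: "(nat \<Rightarrow> nat) \<Rightarrow> nat \<Rightarrow> (nat \<times> nat) set \<Rightarrow> (nat \<times> nat) set" where
  "flip p d x = {(j, i). ((j, i) \<in> x) \<noteq> (j < d \<and> i = p j)}"

lemma flip_flip: "flip p d (flip p d x) = x"
  by (auto simp: flip_def)

lemma twist_flip: "j < d \<Longrightarrow> twist (flip p d x) j i = (twist x j i \<noteq> (p j < i))"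
  by (induction i) (auto simp: flip_def less_Suc_eq)

text \<open>The vertices \<open>v < 2 * L * n\<close> are arranged in \<open>L\<close> positions with two sides of \<open>n\<close> vertices each.
  Shifting position \<open>i\<close> cyclically by \<open>r i\<close> assigns its vertices to blocks; the blocks \<open>j < d\<close> carry
  cycles and all other vertices are isolated. A pair \<open>(j, i) \<in> x\<close> means that block \<open>j\<close> changes sides
  between positions \<open>i\<close> and \<open>i + 1\<close>, so that block \<open>j\<close> is a single cycle of length \<open>2 * L\<close> if
  \<open>twist x j L\<close> and a pair of cycles of length \<open>L\<close> otherwise.\<close>

locale twisted_cycles =
  fixes L n d :: nat
  assumes L: "3 \<le> L" and n: "0 < n" and d: "d \<le> n"
begin

abbreviation N :: nat where "N \<equiv> 2 * L * n"

definition pos :: "nat \<Rightarrow> nat" where "pos v = v div n div 2"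

definition side :: "nat \<Rightarrow> bool" where "side v = odd (v div n)"

definition blk :: "(nat \<Rightarrow> nat) \<Rightarrow> nat \<Rightarrow> nat" where
  "blk r v = (v mod n + r (pos v)) mod n"

definition arc :: "(nat \<Rightarrow> nat) \<Rightarrow> (nat \<times> nat) set \<Rightarrow> nat \<Rightarrow> nat \<Rightarrow> bool" where
  "arc r x u v \<longleftrightarrow> u < N \<and> v < N \<and> blk r u < d \<and> blk r v = blk r u \<and>
     pos v = Suc (pos u) mod L \<and> side v = (side u \<noteq> ((blk r u, pos u) \<in> x))"

definition cycles :: "(nat \<Rightarrow> nat) \<Rightarrow> (nat \<times> nat) set \<Rightarrow> nat \<Rightarrow> nat \<Rightarrow> bool" where
  "cycles r x u v \<longleftrightarrow> arc r x u v \<or> arc r x v u"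

definition shifts :: "(nat \<Rightarrow> nat) set" where
  "shifts = {..<L} \<rightarrow>\<^sub>E {..<n}"

definition crossings :: "bool \<Rightarrow> (nat \<times> nat) set set" where
  "crossings b = {x \<in> Pow ({..<d} \<times> {..<L}). \<forall>j<d. twist x j L = b}"

lemma pos_less: "v < N \<Longrightarrow> pos v < L"
  using less_mult_imp_div_less[of v "2 * L" n] by (simp add: pos_def less_mult_imp_div_less mult.commute)

lemma add_mod_cancel:
  fixes a b c :: nat
  assumes "a < n" "b < n" "(a + c) mod n = (b + c) mod n"
  shows "a = b"
proof -
  have *: "a = b" if "a \<le> b" "b < n" "(a + c) mod n = (b + c) mod n" for a b
  proof -
    have "n dvd (b + c) - (a + c)"
      using that mod_eq_dvd_iff_nat[of "a + c" "b + c" n] by simp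
    then have "n dvd b - a" by simp
    then show ?thesis using that by (auto dest: dvd_imp_le)
  qed
  show ?thesis using *[of a b] *[of b a] assms by (cases "a \<le> b") auto
qed

text \<open>Position, side and block serve as coordinates: at a fixed position the shift is a
  bijection modulo \<open>n\<close>, so the block determines \<open>v mod n\<close>.\<close>

lemma vertex_eqI:
  assumes "pos u = pos v" "side u = side v" "blk r u = blk r v"
  shows "u = v"
proof -
  have "u mod n = v mod n"
  proof (rule add_mod_cancel)
    show "(u mod n + r (pos u)) mod n = (v mod n + r (pos u)) mod n"
      using assms(1,3) by (simp only: blk_def)
  qed (use n in simp_all)
  moreover have "u div n = v div n"
  proof -
    have "a div 2 = b div 2 \<Longrightarrow> odd a = odd b \<Longrightarrow> a = b" for a b :: nat by presburger
    then show ?thesis using assms(1,2) unfolding pos_def side_def by blast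
  qed
  ultimately have "u div n * n + u mod n = v div n * n + v mod n" by (simp only:)
  then show ?thesis by (simp only: div_mult_mod_eq)
qed

lemma vertex_ex:
  assumes "i < L" "j < n" "r \<in> shifts"
  shows "\<exists>v<N. pos v = i \<and> side v = b \<and> blk r v = j"
proof -
  define c where "c = 2 * i + of_bool b"
  \<comment> \<open>Undoes the shift by \<open>r i\<close> modulo \<open>n\<close>; adding
    \<open>n - r i\<close> avoids truncated subtraction.\<close>
  define off where "off = (j + (n - r i)) mod n"
  define v where "v = c * n + off"
  have off: "off < n" using n by (simp add: off_def)
  have ri: "r i < n" using assms(1,3) by (auto simp: shifts_def PiE_iff)
  have "c < 2 * L" using assms(1) by (simp add: c_def)
  then have "Suc c * n \<le> 2 * L * n" by (intro mult_right_mono) auto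
  then have "v < N" using off by (simp add: v_def)
  moreover have div: "v div n = c" and mod: "v mod n = off" using off by (auto simp: v_def)
  moreover have pos: "pos v = i" using div by (simp add: pos_def c_def)
  moreover have "side v = b" using div by (simp add: side_def c_def)
  moreover have "blk r v = j"
  proof -
    have "blk r v = (off + r i) mod n" using mod pos by (simp add: blk_def)
    also have "\<dots> = (j + (n - r i) + r i) mod n" unfolding off_def by (rule mod_add_left_eq)
    also have "j + (n - r i) + r i = j + n" using ri by simp
    finally show ?thesis using assms(2) by simp
  qed
  ultimately show ?thesis by blast
qed

lemma pos_neq: "arc r x u v \<Longrightarrow> pos u \<noteq> pos v"
proof
  assume a: "arc r x u v" and eq: "pos u = pos v"
  have "pos u < L" using a pos_less by (auto simp: arc_def)
  moreover have "pos u = Suc (pos u) mod L" using a eq by (simp add: arc_def)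
  ultimately show False using L by (cases "Suc (pos u) = L") auto
qed

lemma is_graph_cycles: "is_graph N (cycles r x)"
  unfolding is_graph_def cycles_def using pos_neq by (auto simp: arc_def)

text \<open>With an even number of crossings the sides can be relabelled consistently: within block
  \<open>j\<close>, \<open>side v \<noteq> twist x j (pos v)\<close> is constant along arcs. Hence
  the ball of a vertex on a cycle meets each position at most once.\<close>

lemma cycles_in_small_balls:
  assumes "x \<in> crossings False"
  shows "(N, cycles r x) \<in> small_balls N L"
proof -
  have "card ((grow (cycles r x) ^^ L) {u}) \<le> L" if u: "u < N" for u
  proof (cases "blk r u < d")
    case False
    have "(grow (cycles r x) ^^ L) {u} \<subseteq> {u}"
      by (rule grow_funpow_closed) (use False in \<open>auto simp: cycles_def arc_def\<close>)
    then have "card ((grow (cycles r x) ^^ L) {u}) \<le> card {u}" by (intro card_mono) auto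
    then show ?thesis using L by simp
  next
    case True
    let ?j = "blk r u"
    define C where "C = {v. v < N \<and> blk r v = ?j \<and>
      (side v \<noteq> twist x ?j (pos v)) = (side u \<noteq> twist x ?j (pos u))}"
    have tw: "twist x ?j L = False" using assms True by (simp add: crossings_def)
    have *: "(side v \<noteq> twist x ?j (pos v)) = (side w \<noteq> twist x ?j (pos w))"
      if "arc r x v w" "blk r v = ?j" for v w
    proof -
      have lt: "pos v < L" using that pos_less by (auto simp: arc_def)
      have sd: "side w = (side v \<noteq> ((?j, pos v) \<in> x))" and pw: "pos w = Suc (pos v) mod L"
        using that by (auto simp: arc_def)
      have st: "twist x ?j (Suc (pos v)) = (twist x ?j (pos v) \<noteq> ((?j, pos v) \<in> x))" by simp
      \<comment> \<open>At the wrap-around \<open>pos w\<close> is 0, and the even total parity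
        \<open>tw\<close> closes the gap.\<close>
      have "twist x ?j (pos w) = twist x ?j (Suc (pos v))"
      proof (cases "Suc (pos v) = L")
        case True
        then show ?thesis using tw pw by (metis mod_self twist.simps(1))
      next
        case False
        then show ?thesis using lt pw by simp
      qed
      then show ?thesis using sd st by blast
    qed
    have "(grow (cycles r x) ^^ L) {u} \<subseteq> C"
    proof (rule grow_funpow_closed)
      show "{u} \<subseteq> C" using u by (simp add: C_def)
      fix v w assume v: "v \<in> C" and e: "cycles r x v w"
      have "w < N" "blk r w = ?j" using e v by (auto simp: cycles_def arc_def C_def)
      moreover have "blk r v = ?j" using v by (simp add: C_def)
      ultimately show "w \<in> C" using v e *[of v w] *[of w v]
        unfolding C_def cycles_def by blast
    qed
    moreover have inj: "inj_on pos C"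
      by (rule inj_onI, rule vertex_eqI[of _ _ r]) (auto simp: C_def)
    moreover have img: "pos ` C \<subseteq> {..<L}" using pos_less by (auto simp: C_def)
    ultimately have "card ((grow (cycles r x) ^^ L) {u}) \<le> card C"
      by (intro card_mono) (auto intro: inj_on_finite)
    also have "\<dots> \<le> card {..<L}" using inj img by (intro card_inj_on_le) auto
    finally show ?thesis by simp
  qed
  then show ?thesis using is_graph_cycles by (simp add: small_balls_def)
qed

text \<open>Walking once around an odd block ends on the opposite side of the starting position. If
  all its arcs were in \<open>F\<close>, the walk would put \<open>L + 1\<close> distinct vertices
  into one ball of radius \<open>L\<close>.\<close>

lemma missing_arc:
  assumes x: "x \<in> crossings True" and r: "r \<in> shifts" and F: "(N, F) \<in> small_balls N L"
    and j: "j < d"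
  shows "\<exists>u v. blk r u = j \<and> arc r x u v \<and> \<not> F u v"
proof (rule ccontr)
  assume "\<not> ?thesis"
  then have all: "F u v" if "blk r u = j" "arc r x u v" for u v using that by blast
  \<comment> \<open>The vertex reached after \<open>k\<close> steps of the walk; at
    \<open>k = L\<close> it is back at position 0, on the other side.\<close>
  have "\<exists>v<N. pos v = k mod L \<and> side v = twist x j k \<and> blk r v = j" for k
    using L j d r by (intro vertex_ex) auto
  then obtain c where c: "\<And>k. c k < N" "\<And>k. pos (c k) = k mod L"
    "\<And>k. side (c k) = twist x j k" "\<And>k. blk r (c k) = j" by metis
  have "F (c k) (c (Suc k))" if "k < L" for k
    using that j c by (intro all) (auto simp: arc_def mod_Suc_eq)
  then have mem: "c k \<in> (grow F ^^ k) {c 0}" if "k \<le> L" for k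
    using that
  proof (induction k)
    case (Suc k)
    then show ?case using \<open>\<And>k. k < L \<Longrightarrow> F (c k) (c (Suc k))\<close>[of k]
      by (auto simp: mem_grow intro!: bexI[of _ "c k"])
  qed simp
  have "inj_on c {..L}"
  proof (rule inj_onI)
    fix k l assume kl: "k \<in> {..L}" "l \<in> {..L}" and eq: "c k = c l"
    have "k mod L = l mod L" "twist x j k = twist x j l" using c eq by metis+
    moreover have "twist x j L" using x j by (simp add: crossings_def)
    ultimately show "k = l" using kl by (cases "k = L"; cases "l = L") auto
  qed
  then have "card (c ` {..L}) = Suc L" by (simp add: card_image)
  moreover have "c ` {..L} \<subseteq> (grow F ^^ L) {c 0}"
    using mem grow_funpow_mono_steps by fastforce
  moreover have g: "is_graph N F" and le: "card ((grow F ^^ L) {c 0}) \<le> L"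
    using F c(1) by (auto simp: small_balls_def)
  moreover have "finite ((grow F ^^ L) {c 0})" using finite_ball[OF g] c(1) by simp
  ultimately show False by (metis card_mono not_less_eq_eq order_trans)
qed

text \<open>Missing arcs of different blocks are different edges, so at least \<open>d\<close> edges
  have to change.\<close>

lemma cycles_far:
  assumes x: "x \<in> crossings True" and r: "r \<in> shifts"
  shows "eps_far (real d / real N ^ 2) (small_balls N L) N (cycles r x)"
  unfolding eps_far_def
proof (intro allI impI)
  fix F assume F: "(N, F) \<in> small_balls N L"
  have g: "is_graph N F" using F by (simp add: small_balls_def)
  let ?D = "{(u, v). u < v \<and> v < N \<and> cycles r x u v \<noteq> F u v}"
  have "\<exists>e\<in>?D. blk r (fst e) = j" if jd: "j < d" for j
  proof -
    obtain u v where uv: "blk r u = j" "arc r x u v" "\<not> F u v"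
      using missing_arc[OF x r F jd] by blast
    have "u \<noteq> v" using uv(2) pos_neq by blast
    then have "(if u < v then (u, v) else (v, u)) \<in> ?D"
      using uv is_graph_sym[OF g] by (auto simp: cycles_def arc_def)
    moreover have "blk r v = j" using uv by (simp add: arc_def)
    ultimately show ?thesis using uv(1) by (intro bexI[of _ "if u < v then (u, v) else (v, u)"]) auto
  qed
  then have "{..<d} \<subseteq> (\<lambda>e. blk r (fst e)) ` ?D"
    by (intro subsetI) (metis (no_types, lifting) image_eqI lessThan_iff)
  moreover have "finite ?D" by (rule finite_subset[of _ "{..<N} \<times> {..<N}"]) auto
  ultimately have "card {..<d} \<le> card ?D" by (rule surj_card_le[rotated])
  then have "real d \<le> real (graph_dist N (cycles r x) F)" by (simp add: graph_dist_def)
  moreover have "0 < real N" using L n by simp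
  ultimately show "real d / real N ^ 2 * real N ^ 2 \<le> real (graph_dist N (cycles r x) F)"
    by simp
qed

section \<open>Random shifts and parity flips\<close>

lemma finite_shifts: "finite shifts" and card_shifts: "card shifts = n ^ L"
  by (auto simp: shifts_def card_PiE intro!: finite_PiE)

text \<open>Over random shifts a given pair is an edge with probability at most
  \<open>d / n ^ 2\<close>, whatever \<open>x\<close> is: both ends must fall into the same one of
  \<open>d\<close> blocks, and that block fixes the shifts at their two positions.\<close>

lemma card_adjacent_shifts:
  "card {r \<in> shifts. cycles r x u v} * n ^ 2 \<le> d * n ^ L"
proof (cases "u < N \<and> v < N \<and> pos u \<noteq> pos v")
  case False
  have "\<not> cycles r x u v" for r
  proof
    assume "cycles r x u v"
    then show False
      using False pos_neq[of r x u v] pos_neq[of r x v u]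
      unfolding cycles_def arc_def by metis
  qed
  then have "{r \<in> shifts. cycles r x u v} = {}" by simp
  then show ?thesis by (metis card.empty mult_0 zero_le)
next
  case True
  define i where "i = pos u"
  define i' where "i' = pos v"
  have i: "i < L" "i' < L" "i \<noteq> i'" using True pos_less by (auto simp: i_def i'_def)
  define T where "T = {(a, b). a < n \<and> b < n \<and> (u mod n + a) mod n < d \<and>
    (v mod n + b) mod n = (u mod n + a) mod n}"
  \<comment> \<open>Prescribing the shifts at two positions leaves the other \<open>L - 2\<close>
    free.\<close>
  define P where "P ab = (\<Pi>\<^sub>E k\<in>{..<L}. if k = i then {fst ab} else if k = i' then {snd ab} else {..<n})"
    for ab :: "nat \<times> nat"
  have finT: "finite T" by (rule finite_subset[of _ "{..<n} \<times> {..<n}"]) (auto simp: T_def)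
  have inj: "inj_on (\<lambda>(a, b). (u mod n + a) mod n) T"
  proof (rule inj_onI, clarify)
    fix a b a' b' assume ab: "(a, b) \<in> T" "(a', b') \<in> T"
      and eq: "(u mod n + a) mod n = (u mod n + a') mod n"
    have lt: "a < n" "a' < n" "b < n" "b' < n" using ab by (simp_all add: T_def)
    have "(a + u mod n) mod n = (a' + u mod n) mod n" using eq by (simp only: add.commute)
    then have "a = a'" by (rule add_mod_cancel[OF lt(1,2)])
    moreover have "(v mod n + b) mod n = (v mod n + b') mod n"
      using ab eq unfolding T_def by simp
    then have "(b + v mod n) mod n = (b' + v mod n) mod n" by (simp only: add.commute)
    then have "b = b'" by (rule add_mod_cancel[OF lt(3,4)])
    ultimately show "a = a' \<and> b = b'" ..
  qed
  have "card T \<le> card {..<d}"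
    by (rule card_inj_on_le[OF inj]) (auto simp: T_def)
  then have cT: "card T \<le> d" by simp
  have cP: "card (P ab) * n ^ 2 = n ^ L" for ab
  proof -
    let ?c = "\<lambda>k. card (if k = i then {fst ab} else if k = i' then {snd ab} else {..<n})"
    have "card (P ab) = (\<Prod>k<L. ?c k)" by (simp add: P_def card_PiE)
    also have "\<dots> = (\<Prod>k\<in>{..<L} - {i} - {i'}. ?c k)"
      using i by (simp add: prod.remove[of _ i] prod.remove[of _ i'])
    also have "\<dots> = n ^ (L - 2)"
      using i by (subst prod.cong[OF refl, of _ _ "\<lambda>_. n"]) (auto simp: numeral_2_eq_2)
    finally have "card (P ab) * n ^ 2 = n ^ (L - 2 + 2)" by (simp only: power_add)
    moreover have "L - 2 + 2 = L" using L by simp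
    ultimately show ?thesis by (simp only:)
  qed
  have "{r \<in> shifts. cycles r x u v} \<subseteq> (\<Union>ab\<in>T. P ab)"
  proof clarify
    fix r assume r: "r \<in> shifts" and e: "cycles r x u v"
    have "r i < n" "r i' < n" using r i by (auto simp: shifts_def PiE_iff)
    then have "(r i, r i') \<in> T"
      using e by (auto simp: T_def cycles_def arc_def blk_def i_def i'_def)
    moreover have "r \<in> P (r i, r i')"
      using r by (auto simp: P_def shifts_def PiE_iff)
    ultimately show "r \<in> (\<Union>ab\<in>T. P ab)" by blast
  qed
  moreover have "finite (P ab)" for ab by (auto simp: P_def intro!: finite_PiE)
  ultimately have "card {r \<in> shifts. cycles r x u v} \<le> card (\<Union>ab\<in>T. P ab)"
    using finT by (intro card_mono) auto
  also have "\<dots> \<le> (\<Sum>ab\<in>T. card (P ab))" by (rule card_UN_le[OF finT])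
  finally have "card {r \<in> shifts. cycles r x u v} * n ^ 2 \<le> (\<Sum>ab\<in>T. card (P ab)) * n ^ 2"
    by (rule mult_right_mono) simp
  also have "\<dots> = card T * n ^ L" by (simp add: sum_distrib_right cP)
  also have "\<dots> \<le> d * n ^ L" using cT by (rule mult_right_mono) simp
  finally show ?thesis .
qed

text \<open>Toggling one crossing per block reverses every parity. The free choice of
  \<open>p\<close> later lets the toggled positions avoid the queries.\<close>

lemma bij_flip:
  assumes "\<And>j. j < d \<Longrightarrow> p j < L"
  shows "bij_betw (flip p d) (crossings b) (crossings (\<not> b))"
proof (rule bij_betw_byWitness[where f' = "flip p d"])
  have "flip p d x \<in> crossings (\<not> b)" if "x \<in> crossings b" for x b
    using that assms by (auto simp: crossings_def twist_flip) (auto simp: flip_def)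
  from this[of _ b] this[of _ "\<not> b"]
  show "flip p d ` crossings b \<subseteq> crossings (\<not> b)" "flip p d ` crossings (\<not> b) \<subseteq> crossings b"
    by auto
qed (simp_all add: flip_flip)

lemma crossings_nonempty: "crossings b \<noteq> {}"
proof -
  have "\<not> twist {} j i" for j i by (induction i) auto
  then have "{} \<in> crossings False" by (simp add: crossings_def)
  then show ?thesis using bij_flip[of "\<lambda>_. 0" False] L by (cases b) (auto simp: bij_betw_def)
qed

lemma finite_crossings: "finite (crossings b)"
  by (simp add: crossings_def)

lemma card_crossings: "card (crossings b) = card (crossings False)"
  using bij_betw_same_card[OF bij_flip[of "\<lambda>_. 0" False]] L by (cases b) auto

end

section \<open>Lower bounds\<close>

text \<open>Averaging over internal randomness, the easy direction of Yao's principle: a count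
  inequality for every deterministic tree carries over to probabilities, so the lower bounds treat
  single trees only.\<close>

lemma sum_prob_le:
  fixes p :: "'a pmf"
  assumes "finite I" "finite J"
    and le: "\<And>t. t \<in> set_pmf p \<Longrightarrow>
      a * real (card {i \<in> I. A i t}) \<le> real (card {j \<in> J. B j t}) + c"
  shows "a * (\<Sum>i\<in>I. measure_pmf.prob p {t. A i t}) \<le> (\<Sum>j\<in>J. measure_pmf.prob p {t. B j t}) + c"
proof -
  have card_eq: "real (card {i \<in> I. A i t}) = (\<Sum>i\<in>I. indicator {t. A i t} t)"
    if "finite I" for I :: "'i set" and A t
    using that by (simp add: indicator_def sum.If_cases Int_def)
  have int: "integrable (measure_pmf p) (\<lambda>t. real (card {i \<in> I. A i t}))"
    if "finite I" for I :: "'i set" and A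
    unfolding card_eq[OF that] by (intro Bochner_Integration.integrable_sum integrable_real_indicator)
      (simp_all add: less_top[symmetric])
  have expect: "(\<Sum>i\<in>I. measure_pmf.prob p {t. A i t})
      = measure_pmf.expectation p (\<lambda>t. real (card {i \<in> I. A i t}))"
    if "finite I" for I :: "'i set" and A
    unfolding card_eq[OF that]
    by (subst Bochner_Integration.integral_sum) (auto intro!: integrable_real_indicator simp: less_top[symmetric])
  have "a * (\<Sum>i\<in>I. measure_pmf.prob p {t. A i t})
      = measure_pmf.expectation p (\<lambda>t. a * real (card {i \<in> I. A i t}))"
    unfolding expect[OF assms(1)] by simp
  also have "\<dots> \<le> measure_pmf.expectation p (\<lambda>t. real (card {j \<in> J. B j t}) + c)"
    by (intro integral_mono_AE)
       (use int[OF assms(1)] int[OF assms(2)] le in \<open>auto simp: AE_measure_pmf_iff\<close>)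
  also have "\<dots> = (\<Sum>j\<in>J. measure_pmf.prob p {t. B j t}) + c"
    unfolding expect[OF assms(2)] using int[OF assms(2)] by (subst Bochner_Integration.integral_add) auto
  finally show ?thesis .
qed

text \<open>The queries along the all-zero path, that is, those made on the empty graph.\<close>

fun probes :: "dtree \<Rightarrow> (nat \<times> nat) list" where
  "probes (Leaf b) = []"
| "probes (Query u v l r) = (u, v) # probes l"

lemma length_probes: "length (probes t) = queries_made t (\<lambda>_ _. False)"
  by (induction t) auto

lemma run_tree_no_hit:
  "\<forall>(u, v)\<in>set (probes t). \<not> E u v \<Longrightarrow> run_tree t E = run_tree t (\<lambda>_ _. False)"
  by (induction t) auto

lemma empty_in_small_balls: "1 \<le> L \<Longrightarrow> (N, \<lambda>_ _. False) \<in> small_balls N L"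
proof -
  assume L: "1 \<le> L"
  have "(grow (\<lambda>_ _. False) ^^ L) {u} \<subseteq> {u}" for u
    by (rule grow_funpow_closed) auto
  then have "card ((grow (\<lambda>_ _. False) ^^ L) {u}) \<le> card {u}" for u by (intro card_mono) auto
  then show ?thesis using L by (auto simp: small_balls_def is_graph_def intro: order_trans)
qed

section \<open>Adaptive lower bound: finding any edge\<close>

context twisted_cycles
begin

text \<open>The empty graph must be accepted and an odd \<open>cycles r x\<close> rejected. A tree
  accepting the former errs on the latter unless one of its at most \<open>q\<close> probes hits an
  edge. By a union bound this happens for at most a fraction \<open>q * d / n ^ 2\<close> of the
  shifts, which therefore has to exceed 1/3.\<close>

lemma adaptive_lower_bound:
  assumes T: "is_tester (real d / real N ^ 2) (small_balls N L) T" "max_queries_le T q"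
  shows "n ^ 2 \<le> 3 * (q * d)"
proof -
  obtain x where x: "x \<in> crossings True" using crossings_nonempty by blast
  let ?E0 = "\<lambda>_ _ :: nat. False"
  let ?S = "real (card shifts)"
  let ?c = "real (q * d) * ?S / real n ^ 2"
  have E0: "is_graph N ?E0" by (simp add: is_graph_def)
  have S: "0 < ?S" using n by (simp add: card_shifts)
  \<comment> \<open>The singleton \<open>{()}\<close> brings the empty graph into the form of
    \<open>sum_prob_le\<close>, weighted by the number of shifts.\<close>
  have "?S * real (card {i \<in> {()}. run_tree t ?E0})
      \<le> real (card {r \<in> shifts. run_tree t (cycles r x)}) + ?c" if t: "t \<in> set_pmf (T N)" for t
  proof (cases "run_tree t ?E0")
    case False
    then show ?thesis by simp
  next
    case True
    let ?hit = "\<lambda>(u, v). {r \<in> shifts. cycles r x u v}"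
    have "shifts \<subseteq> {r \<in> shifts. run_tree t (cycles r x)} \<union> (\<Union>e\<in>set (probes t). ?hit e)"
      using run_tree_no_hit[of t "cycles _ x"] True by fastforce
    then have "card shifts \<le> card ({r \<in> shifts. run_tree t (cycles r x)} \<union> (\<Union>e\<in>set (probes t). ?hit e))"
      using finite_shifts by (intro card_mono) auto
    also have "\<dots> \<le> card {r \<in> shifts. run_tree t (cycles r x)} + card (\<Union>e\<in>set (probes t). ?hit e)"
      by (rule card_Un_le)
    finally have le: "?S \<le> real (card {r \<in> shifts. run_tree t (cycles r x)})
        + real (card (\<Union>e\<in>set (probes t). ?hit e))" by linarith
    have "card (\<Union>e\<in>set (probes t). ?hit e) * n ^ 2 \<le> (\<Sum>e\<in>set (probes t). card (?hit e)) * n ^ 2"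
      by (intro mult_right_mono card_UN_le) auto
    also have "\<dots> = (\<Sum>e\<in>set (probes t). card (?hit e) * n ^ 2)" by (rule sum_distrib_right)
    also have "\<dots> \<le> (\<Sum>e\<in>set (probes t). d * n ^ L)"
      by (intro sum_mono) (auto simp: card_adjacent_shifts)
    also have "\<dots> = card (set (probes t)) * (d * n ^ L)" by simp
    also have "\<dots> \<le> q * (d * n ^ L)"
    proof (rule mult_right_mono)
      have "card (set (probes t)) \<le> queries_made t ?E0"
        by (metis card_length length_probes)
      also have "\<dots> \<le> q" using T(2) E0 t by (simp add: max_queries_le_def)
      finally show "card (set (probes t)) \<le> q" .
    qed simp
    finally have "real (card (\<Union>e\<in>set (probes t). ?hit e) * n ^ 2) \<le> real (q * (d * n ^ L))"
      by (rule of_nat_mono)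
    then have "real (card (\<Union>e\<in>set (probes t). ?hit e)) * real n ^ 2 \<le> real (q * d) * ?S"
      by (simp add: card_shifts mult_ac)
    then have "real (card (\<Union>e\<in>set (probes t). ?hit e)) \<le> ?c"
      using n by (simp add: pos_le_divide_eq)
    then show ?thesis using le True by simp
  qed
  from sum_prob_le[OF _ finite_shifts this]
  have "?S * accept_prob T N ?E0 \<le> (\<Sum>r\<in>shifts. accept_prob T N (cycles r x)) + ?c"
    by (simp add: accept_prob_def)
  also have "(\<Sum>r\<in>shifts. accept_prob T N (cycles r x)) \<le> (\<Sum>r\<in>shifts. 1 / 3)"
  proof (rule sum_mono)
    fix r assume "r \<in> shifts"
    then show "accept_prob T N (cycles r x) \<le> 1 / 3"
      using T(1) cycles_far[OF x] is_graph_cycles[of r x] unfolding is_tester_def by fastforce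
  qed
  finally have "?S * accept_prob T N ?E0 \<le> ?S / 3 + ?c" by simp
  moreover have "accept_prob T N ?E0 > 2 / 3"
    using T(1) E0 empty_in_small_balls[of L N] L by (simp add: is_tester_def)
  then have "?S * (2 / 3) < ?S * accept_prob T N ?E0" using S by (rule mult_strict_left_mono)
  ultimately have "?S / 3 < ?c" by linarith
  then have "?S * real n ^ 2 < ?S * (3 * real (q * d))"
    using n by (simp add: pos_less_divide_eq mult_ac)
  then have "real n ^ 2 < 3 * real (q * d)" using S by (simp only: mult_less_cancel_left_pos)
  then have "real (n ^ 2) < real (3 * (q * d))" by simp
  then show ?thesis by linarith
qed

section \<open>Non-adaptive lower bound: learning a parity\<close>

text \<open>Only the positions \<open>2 * p\<close> and \<open>2 * p + 1\<close> are paired: distinct \<open>p\<close> then involve disjoint, hence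
  independent, shifts.\<close>

definition touches :: "(nat \<Rightarrow> nat) \<Rightarrow> nat \<Rightarrow> nat \<Rightarrow> nat \<Rightarrow> nat \<Rightarrow> bool" where
  "touches r j p u v \<longleftrightarrow> blk r u = j \<and> blk r v = j \<and>
     (pos u = 2 * p \<and> pos v = 2 * p + 1 \<or> pos u = 2 * p + 1 \<and> pos v = 2 * p)"

text \<open>For fixed \<open>j\<close> and \<open>p\<close>, each query touches for at most one pair
  of shifts at \<open>2 * p\<close> and \<open>2 * p + 1\<close>. As \<open>L = 2 * H\<close>, these
  \<open>H\<close> pairs determine \<open>r\<close>, with at most \<open>length qs\<close> choices
  for each.\<close>

lemma card_all_touched:
  assumes H: "L = 2 * H"
  shows "card {r \<in> shifts. \<forall>p<H. \<exists>(u, v)\<in>set qs. touches r j p u v} \<le> length qs ^ H"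
proof -
  define Tq where "Tq p e = {(a, b). a < n \<and> b < n \<and> (case e of (u, v) \<Rightarrow>
     pos u = 2 * p \<and> pos v = 2 * p + 1 \<and> (u mod n + a) mod n = j \<and> (v mod n + b) mod n = j \<or>
     pos u = 2 * p + 1 \<and> pos v = 2 * p \<and> (v mod n + a) mod n = j \<and> (u mod n + b) mod n = j)}"
    for p and e :: "nat \<times> nat"
  define Tp where "Tp p = (\<Union>e\<in>set qs. Tq p e)" for p
  have finTq: "finite (Tq p e)" for p e
    by (rule finite_subset[of _ "{..<n} \<times> {..<n}"]) (auto simp: Tq_def)
  have unique: "a = a'" if "a < n" "a' < n" "(w + a) mod n = j" "(w + a') mod n = j" for a a' w
    by (rule add_mod_cancel[OF that(1,2), of w]) (use that(3,4) in \<open>simp add: add.commute\<close>)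
  have cTq: "card (Tq p e) \<le> 1" for p e
  proof -
    have "x = y" if "x \<in> Tq p e" "y \<in> Tq p e" for x y
      using that unique[of "fst x" "fst y"] unique[of "snd x" "snd y"]
      by (auto simp: Tq_def split: prod.splits)
    then show ?thesis using card_le_Suc0_iff_eq[OF finTq] by simp
  qed
  have cTp: "card (Tp p) \<le> length qs" for p
  proof -
    have "card (Tp p) \<le> (\<Sum>e\<in>set qs. card (Tq p e))" unfolding Tp_def by (intro card_UN_le) auto
    also have "\<dots> \<le> (\<Sum>e\<in>set qs. 1)" by (intro sum_mono cTq)
    also have "\<dots> \<le> length qs" by (simp add: card_length)
    finally show ?thesis .
  qed
  let ?R = "{r \<in> shifts. \<forall>p<H. \<exists>(u, v)\<in>set qs. touches r j p u v}"
  let ?g = "\<lambda>r. \<lambda>p\<in>{..<H}. (r (2 * p), r (2 * p + 1))"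
  have "inj_on ?g ?R"
  proof (rule inj_onI)
    fix r s assume rs: "r \<in> ?R" "s \<in> ?R" and eq: "?g r = ?g s"
    have "r i = s i" if "i < L" for i
    proof -
      have lt: "i div 2 < H" using that H by simp
      then have "r (2 * (i div 2)) = s (2 * (i div 2))" "r (2 * (i div 2) + 1) = s (2 * (i div 2) + 1)"
        using fun_cong[OF eq, of "i div 2"] by simp_all
      then show ?thesis by (cases "even i") (auto elim!: evenE oddE)
    qed
    then show "r = s" using rs by (auto simp: shifts_def intro: PiE_ext)
  qed
  moreover have "?g ` ?R \<subseteq> (\<Pi>\<^sub>E p\<in>{..<H}. Tp p)"
  proof clarify
    fix r assume r: "r \<in> shifts" and all: "\<forall>p<H. \<exists>(u, v)\<in>set qs. touches r j p u v"
    have "(r (2 * p), r (2 * p + 1)) \<in> Tp p" if p: "p < H" for p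
    proof -
      obtain u v where uv: "(u, v) \<in> set qs" "touches r j p u v" using all p by blast
      have "2 * p < L" "2 * p + 1 < L" using p H by simp_all
      then have "r (2 * p) < n" "r (2 * p + 1) < n"
        using r unfolding shifts_def PiE_iff by blast+
      then have "(r (2 * p), r (2 * p + 1)) \<in> Tq p (u, v)"
        using uv(2) by (auto simp: Tq_def touches_def blk_def)
      then show ?thesis using uv(1) unfolding Tp_def by blast
    qed
    then show "?g r \<in> (\<Pi>\<^sub>E p\<in>{..<H}. Tp p)" by (simp add: PiE_iff)
  qed
  moreover have "finite (\<Pi>\<^sub>E p\<in>{..<H}. Tp p)" using finTq by (intro finite_PiE) (auto simp: Tp_def)
  ultimately have "card ?R \<le> card (\<Pi>\<^sub>E p\<in>{..<H}. Tp p)" by (rule card_inj_on_le)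
  also have "\<dots> = (\<Prod>p<H. card (Tp p))" by (simp add: card_PiE)
  also have "\<dots> \<le> (\<Prod>p<H. length qs)" using cTp by (intro prod_mono) auto
  finally show ?thesis by simp
qed

text \<open>Non-adaptively, a block with an untouched rung has the same view under both parities.\<close>

lemma cycles_flip_untouched:
  assumes H: "L = 2 * H" and p: "\<And>j. j < d \<Longrightarrow> p j < H"
    and untouched: "\<And>j. j < d \<Longrightarrow> \<not> touches r j (p j) u v"
  shows "cycles r (flip (\<lambda>j. 2 * p j) d x) u v = cycles r x u v"
proof -
  have "arc r (flip (\<lambda>j. 2 * p j) d x) u v = arc r x u v"
    if nt: "\<And>j. j < d \<Longrightarrow> \<not> touches r j (p j) u v" for u v
  proof (cases "blk r u < d \<and> blk r v = blk r u \<and> pos v = Suc (pos u) mod L")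
    case False
    then show ?thesis by (auto simp: arc_def)
  next
    case True
    have "pos u \<noteq> 2 * p (blk r u)"
    proof
      assume eq: "pos u = 2 * p (blk r u)"
      \<comment> \<open>Since \<open>2 * p + 1 < L\<close>, an arc out of position
        \<open>2 * p\<close> does not wrap around.\<close>
      then have "Suc (pos u) < L" using p[of "blk r u"] True H by simp
      then have "touches r (blk r u) (p (blk r u)) u v" using True eq by (simp add: touches_def)
      then show False using nt True by blast
    qed
    then have "((blk r u, pos u) \<in> flip (\<lambda>j. 2 * p j) d x) = ((blk r u, pos u) \<in> x)"
      by (simp add: flip_def)
    then show ?thesis by (simp add: arc_def)
  qed
  from this[of u v] this[of v u] show ?thesis
    using untouched by (auto simp: cycles_def touches_def)
qed

text \<open>Random even and odd instances are compared. Unless some block is touched at every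
  \<open>p\<close>, a flip at untouched positions matches the accepted instances of both kinds. If
  \<open>2 * q \<le> n ^ 2\<close>, the exceptional shifts form a fraction of at most
  \<open>d * q ^ H / n ^ L \<le> d / 2 ^ H < 1 / 3\<close>, too little for the gap between 2/3 and
  1/3.\<close>

lemma nonadaptive_lower_bound:
  assumes T: "is_tester (real d / real N ^ 2) (small_balls N L) T" "non_adaptive T" "max_queries_le T q"
    and H: "L = 2 * H" and big: "3 * d < 2 ^ H"
  shows "n ^ 2 \<le> 2 * q"
proof (rule ccontr)
  assume "\<not> n ^ 2 \<le> 2 * q"
  then have q: "2 * q \<le> n ^ 2" by simp
  let ?X = "real (card (crossings False))"
  let ?S = "real (card shifts)"
  let ?c = "real (d * q ^ H) * ?X"
  have S: "0 < ?S" using n by (simp add: card_shifts)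
  have X: "0 < ?X" using crossings_nonempty finite_crossings by (simp add: card_gt_0_iff)
  have "1 * real (card {rx \<in> shifts \<times> crossings False. run_tree t (cycles (fst rx) (snd rx))})
      \<le> real (card {rx \<in> shifts \<times> crossings True. run_tree t (cycles (fst rx) (snd rx))}) + ?c"
    if t: "t \<in> set_pmf (T N)" for t
  proof -
    obtain qs f where qs: "t = na_tree qs f" using T(2) t unfolding non_adaptive_def by blast
    \<comment> \<open>The number of queries of \<open>na_tree\<close> is the same on all graphs, so
      an arbitrary one, with \<open>undefined\<close> shifts, instantiates the bound.\<close>
    have len: "length qs \<le> q"
      using T(3) t is_graph_cycles[of undefined "{}"] queries_na_tree[of qs f]
      unfolding max_queries_le_def qs by metis
    let ?acc = "\<lambda>b r. {x \<in> crossings b. run_tree t (cycles r x)}"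
    let ?bad = "{r \<in> shifts. \<exists>j<d. \<forall>p<H. \<exists>(u, v)\<in>set qs. touches r j p u v}"
    have split: "card {rx \<in> shifts \<times> crossings b. run_tree t (cycles (fst rx) (snd rx))}
        = (\<Sum>r\<in>shifts. card (?acc b r))" for b
    proof -
      have "{rx \<in> shifts \<times> crossings b. run_tree t (cycles (fst rx) (snd rx))}
          = (SIGMA r:shifts. ?acc b r)" by auto
      then show ?thesis using finite_shifts finite_crossings by simp
    qed
    have good: "card (?acc False r) = card (?acc True r)" if r: "r \<in> shifts" "r \<notin> ?bad" for r
    proof -
      \<comment> \<open>Here non-adaptivity enters: \<open>qs\<close> is fixed in advance, so
        \<open>p\<close> depends on \<open>r\<close> but not on \<open>x\<close>, and flipping at
        \<open>p\<close> is a bijection.\<close>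
      have "\<forall>j. \<exists>p. j < d \<longrightarrow> p < H \<and> (\<forall>(u, v)\<in>set qs. \<not> touches r j p u v)" using r by blast
      from choice[OF this] obtain p
        where "\<forall>j. j < d \<longrightarrow> p j < H \<and> (\<forall>(u, v)\<in>set qs. \<not> touches r j (p j) u v)" ..
      then have p: "\<And>j. j < d \<Longrightarrow> p j < H"
        "\<And>j u v. j < d \<Longrightarrow> (u, v) \<in> set qs \<Longrightarrow> \<not> touches r j (p j) u v" by auto
      let ?\<phi> = "flip (\<lambda>j. 2 * p j) d"
      have bij: "bij_betw ?\<phi> (crossings False) (crossings True)"
        using bij_flip[of "\<lambda>j. 2 * p j" False] p(1) H by simp
      have "map (case_prod (cycles r (?\<phi> x))) qs = map (case_prod (cycles r x)) qs" for x
        using cycles_flip_untouched[OF H p(1)] p(2) by (auto cong: map_cong)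
      then have run: "run_tree t (cycles r (?\<phi> x)) = run_tree t (cycles r x)" for x
        by (simp only: qs run_na_tree)
      have "bij_betw ?\<phi> (?acc False r) (?acc True r)"
        by (rule bij_betw_Collect[OF bij]) (simp add: run)
      then show ?thesis by (rule bij_betw_same_card)
    qed
    have "card (?acc False r) \<le> card (?acc True r) + (if r \<in> ?bad then card (crossings False) else 0)"
      if "r \<in> shifts" for r
    proof (cases "r \<in> ?bad")
      case True
      have "card (?acc False r) \<le> card (crossings False)" using finite_crossings by (intro card_mono) auto
      then show ?thesis using True by simp
    next
      case False
      then show ?thesis using good[OF that] by simp
    qed
    then have "(\<Sum>r\<in>shifts. card (?acc False r))
        \<le> (\<Sum>r\<in>shifts. card (?acc True r) + (if r \<in> ?bad then card (crossings False) else 0))"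
      by (rule sum_mono)
    also have "\<dots> = (\<Sum>r\<in>shifts. card (?acc True r)) + card ?bad * card (crossings False)"
      using finite_shifts by (simp add: sum.distrib sum.If_cases Int_def)
    also have "card ?bad \<le> d * q ^ H"
    proof -
      have bad: "?bad = (\<Union>j<d. {r \<in> shifts. \<forall>p<H. \<exists>(u, v)\<in>set qs. touches r j p u v})" by blast
      have "card ?bad \<le> (\<Sum>j<d. card {r \<in> shifts. \<forall>p<H. \<exists>(u, v)\<in>set qs. touches r j p u v})"
        unfolding bad by (rule card_UN_le) simp
      also have "\<dots> \<le> (\<Sum>j<d. q ^ H)"
        using power_mono[OF len] by (intro sum_mono order_trans[OF card_all_touched[OF H]]) simp
      finally show ?thesis by simp
    qed
    finally have "(\<Sum>r\<in>shifts. card (?acc False r))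
        \<le> (\<Sum>r\<in>shifts. card (?acc True r)) + d * q ^ H * card (crossings False)" by simp
    then have "real (\<Sum>r\<in>shifts. card (?acc False r))
        \<le> real ((\<Sum>r\<in>shifts. card (?acc True r)) + d * q ^ H * card (crossings False))"
      by (rule of_nat_mono)
    then show ?thesis unfolding split by simp
  qed
  from sum_prob_le[OF finite_cartesian_product[OF finite_shifts finite_crossings]
      finite_cartesian_product[OF finite_shifts finite_crossings] this]
  have le: "(\<Sum>rx\<in>shifts \<times> crossings False. accept_prob T N (cycles (fst rx) (snd rx)))
      \<le> (\<Sum>rx\<in>shifts \<times> crossings True. accept_prob T N (cycles (fst rx) (snd rx))) + ?c"
    unfolding accept_prob_def mult_1 .
  have "(\<Sum>rx\<in>shifts \<times> crossings False. 2 / 3)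
      \<le> (\<Sum>rx\<in>shifts \<times> crossings False. accept_prob T N (cycles (fst rx) (snd rx)))"
  proof (rule sum_mono)
    fix rx assume "rx \<in> shifts \<times> crossings False"
    then have "(N, cycles (fst rx) (snd rx)) \<in> small_balls N L" by (auto intro: cycles_in_small_balls)
    then show "2 / 3 \<le> accept_prob T N (cycles (fst rx) (snd rx))"
      using T(1) is_graph_cycles[of "fst rx" "snd rx"] unfolding is_tester_def by fastforce
  qed
  moreover have "(\<Sum>rx\<in>shifts \<times> crossings True. accept_prob T N (cycles (fst rx) (snd rx)))
      \<le> (\<Sum>rx\<in>shifts \<times> crossings True. 1 / 3)"
  proof (rule sum_mono)
    fix rx assume "rx \<in> shifts \<times> crossings True"
    then have "eps_far (real d / real N ^ 2) (small_balls N L) N (cycles (fst rx) (snd rx))"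
      by (intro cycles_far) auto
    then show "accept_prob T N (cycles (fst rx) (snd rx)) \<le> 1 / 3"
      using T(1) is_graph_cycles[of "fst rx" "snd rx"] unfolding is_tester_def by fastforce
  qed
  ultimately have "?S * ?X * (2 / 3) \<le> ?S * ?X * (1 / 3) + ?c"
    using le card_crossings[of True] by (simp add: card_cartesian_product)
  then have "?S * ?X \<le> 3 * real (d * q ^ H) * ?X" by simp
  then have "?S \<le> real (3 * (d * q ^ H))" using X by simp
  then have "n ^ L \<le> 3 * (d * q ^ H)" using card_shifts by linarith
  then have "2 ^ H * n ^ L \<le> 3 * d * (2 * q) ^ H" by (simp add: power_mult_distrib)
  also have "\<dots> \<le> 3 * d * (n ^ 2) ^ H" using q by (intro mult_left_mono power_mono) auto
  also have "\<dots> = 3 * d * n ^ L" by (simp add: H power_mult)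
  finally have "2 ^ H \<le> 3 * d" using n by simp
  then show False using big by simp
qed

end

section \<open>Query complexities\<close>

text \<open>Attainment means that the query complexities belong to actual testers, to which the
  lower bounds apply.\<close>

lemma Inf_enat_attained:
  assumes "P (k :: nat)"
  shows "\<exists>q. Inf {enat k | k. P k} = enat q \<and> P q \<and> q \<le> k"
proof -
  let ?S = "{enat k | k. P k}"
  have mem: "enat k \<in> ?S" using assms by blast
  then have eq: "Inf ?S = (LEAST x. x \<in> ?S)" by (auto simp: Inf_enat_def)
  have "Inf ?S \<in> ?S" unfolding eq using mem by (rule LeastI)
  then obtain q where q: "Inf ?S = enat q" "P q" by blast
  have "Inf ?S \<le> enat k" using mem by (rule Inf_lower)
  then show ?thesis using q by auto
qed

text \<open>\<open>4 * L ^ 2 * A\<close> stands for the inverse of the distance parameter and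
  \<open>l\<close> for its logarithm. All losses are powers of \<open>L\<close>, hence of
  \<open>l\<close>. The worst is \<open>(32 * L ^ 5) ^ 2\<close>, from raising the bound on
  \<open>q\<close> to a power of at most 2; it explains \<open>l ^ 10\<close> and
  \<open>C = 2 * 32 ^ 2 * 12 ^ 10\<close>.\<close>

lemma complexity_bounds:
  fixes A L l q Q e :: real
  assumes "1 \<le> A" "1 \<le> L" "L \<le> 12 * l" "1 \<le> l" "A \<le> 3 * q" "q \<le> 32 * L ^ 5 * A"
    and e: "0 \<le> e" "e \<le> 2"
    and Q: "A powr e \<le> 2 * Q" "Q \<le> 4 * L ^ 2 * A powr e"
  defines "C \<equiv> 2048 * 12 ^ 10"
  shows "1 / C * (4 * L ^ 2 * A) / l ^ 10 \<le> q"
    and "q \<le> C * (4 * L ^ 2 * A) * l ^ 10"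
    and "1 / C * q powr e / l ^ 10 \<le> Q"
    and "Q \<le> C * q powr e * l ^ 10"
proof -
  have q0: "0 < q" using assms(1,5) by linarith
  have Lp: "L ^ i \<le> 12 ^ i * l ^ j" if "i \<le> j" for i j
  proof -
    have "L ^ i \<le> (12 * l) ^ i" using assms by (intro power_mono) auto
    also have "\<dots> = 12 ^ i * l ^ i" by (rule power_mult_distrib)
    also have "\<dots> \<le> 12 ^ i * l ^ j" using that assms(4) by (intro mult_left_mono power_increasing) auto
    finally show ?thesis .
  qed
  have C: "0 < C" by (simp add: C_def)
  have l: "0 < l ^ 10" using assms(4) by simp
  have "4 * L ^ 2 * A \<le> 4 * (12 ^ 2 * l ^ 10) * (3 * q)"
    using Lp[of 2 10] assms by (intro mult_mono) auto
  also have "\<dots> = 1728 * (q * l ^ 10)" by simp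
  also have "\<dots> \<le> C * (q * l ^ 10)" using q0 l by (intro mult_right_mono) (auto simp: C_def)
  finally have "4 * L ^ 2 * A \<le> C * (q * l ^ 10)" .
  then show "1 / C * (4 * L ^ 2 * A) / l ^ 10 \<le> q"
    using C l by (simp add: divide_le_eq mult_ac)
  have "32 * L ^ 5 * A = 8 * L ^ 3 * (4 * L ^ 2 * A)" by (simp add: power_numeral_reduce)
  then have "q \<le> 8 * L ^ 3 * (4 * L ^ 2 * A)" using assms(6) by simp
  also have "\<dots> \<le> 8 * (12 ^ 3 * l ^ 10) * (4 * L ^ 2 * A)"
    using Lp[of 3 10] assms(1,2) by (intro mult_right_mono mult_left_mono) auto
  also have "\<dots> = 13824 * ((4 * L ^ 2 * A) * l ^ 10)" by simp
  also have "\<dots> \<le> C * ((4 * L ^ 2 * A) * l ^ 10)"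
    using l assms(1) by (intro mult_right_mono) (auto simp: C_def)
  finally show "q \<le> C * (4 * L ^ 2 * A) * l ^ 10" by (simp only: mult.assoc)
  have "q powr e \<le> (32 * L ^ 5 * A) powr e" using q0 assms(6) e by (intro powr_mono2) auto
  also have "\<dots> = (32 * L ^ 5) powr e * A powr e" using assms(1,2) by (simp add: powr_mult)
  also have "\<dots> \<le> (32 * L ^ 5) powr 2 * A powr e"
  proof (intro mult_right_mono powr_mono)
    have "1 \<le> L ^ 5" using assms(2) by (rule one_le_power)
    then show "1 \<le> 32 * L ^ 5" by simp
  qed (use e in auto)
  also have "(32 * L ^ 5) powr 2 = 1024 * L ^ 10"
    using assms(2) by (simp add: powr_numeral power_mult_distrib flip: power_mult)
  also have "1024 * L ^ 10 * A powr e \<le> 1024 * (12 ^ 10 * l ^ 10) * (2 * Q)"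
    using Lp[of 10 10] Q(1) l by (intro mult_mono) auto
  also have "\<dots> = C * (Q * l ^ 10)" by (simp add: C_def)
  finally show "1 / C * q powr e / l ^ 10 \<le> Q"
    using C l by (simp add: divide_le_eq mult_ac)
  have "A powr e \<le> (3 * q) powr e" using assms(1,5) e by (intro powr_mono2) auto
  also have "\<dots> = 3 powr e * q powr e" using q0 by (simp add: powr_mult)
  also have "\<dots> \<le> 3 powr 2 * q powr e" using e by (intro mult_right_mono powr_mono) auto
  finally have Aq: "A powr e \<le> 9 * q powr e" by simp
  have "Q \<le> 4 * L ^ 2 * A powr e" by (rule Q(2))
  also have "\<dots> \<le> 4 * (12 ^ 2 * l ^ 10) * (9 * q powr e)"
    using Lp[of 2 10] Aq l by (intro mult_mono) auto
  also have "\<dots> = 5184 * (q powr e * l ^ 10)" by simp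
  also have "\<dots> \<le> C * (q powr e * l ^ 10)"
    using l by (intro mult_right_mono) (auto simp: C_def)
  finally show "Q \<le> C * q powr e * l ^ 10" by (simp only: mult.assoc)
qed

text \<open>With \<open>A = 2 ^ (m * t)\<close>, the identity \<open>n ^ 2 = d * A\<close> makes the
  adaptive lower bound of order \<open>A\<close>, and \<open>2 ^ m * n = A\<close> makes the
  exploration cost \<open>24 * L ^ 5 * A\<close>. The summand 2 in \<open>L\<close> yields
  \<open>2 ^ (L div 2) = 4 * n > 3 * d\<close> for the non-adaptive bound.\<close>

lemma query_complexity_small_balls:
  fixes m t :: nat
  assumes "1 \<le> m" "2 \<le> t"
  defines "L \<equiv> 2 * (m * (t - 1) + 2)" and "n \<equiv> 2 ^ (m * (t - 1))" and "d \<equiv> 2 ^ (m * (t - 2))"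
  defines "N \<equiv> 2 * L * n"
  defines "\<epsilon> \<equiv> real d / real N ^ 2"
  shows "\<exists>q Q. adaptive_qc \<epsilon> (small_balls N L) = enat q \<and>
    nonadaptive_qc \<epsilon> (small_balls N L) = enat Q \<and>
    2 ^ (m * t) \<le> 3 * q \<and> q \<le> 32 * L ^ 5 * 2 ^ (m * t) \<and>
    n ^ 2 \<le> 2 * Q \<and> Q \<le> 4 * L ^ 2 * n ^ 2"
proof -
  define H where "H = m * (t - 1) + 2"
  define A :: nat where "A = 2 ^ (m * t)"
  have LH: "L = 2 * H" by (simp add: L_def H_def)
  have L3: "3 \<le> L" and n0: "0 < n" and d0: "0 < d" by (simp_all add: L_def n_def d_def)
  have nd: "n = 2 ^ m * d"
    using assms(2) unfolding n_def d_def power_add[symmetric] mult_Suc_right[symmetric]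
    by (simp add: Suc_diff_Suc numeral_2_eq_2)
  have nA: "2 ^ m * n = A"
    using assms(2) unfolding n_def A_def power_add[symmetric] mult_Suc_right[symmetric] by simp
  have n2: "n ^ 2 = d * A" using nA nd by (simp add: power2_eq_square)
  have dn: "d \<le> n" unfolding nd by simp
  interpret twisted_cycles L n d by unfold_locales (use L3 n0 dn in auto)
  have N0: "0 < N" using L3 n0 by (simp add: N_def)
  have NN: "N * N = 4 * L ^ 2 * A * d"
    by (simp add: N_def n2[unfolded power2_eq_square, symmetric] power2_eq_square)
      (metis mult.assoc mult.commute n2 power2_eq_square)
  have big: "3 * d < 2 ^ H"
  proof -
    have "(2 ^ H :: nat) = 4 * n" by (simp add: H_def n_def power_add)
    then show ?thesis using dn n0 by simp
  qed
  have eps0: "0 < \<epsilon>" using d0 N0 by (simp add: \<epsilon>_def)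
  \<comment> \<open>The sample size \<open>8 * L ^ 2 * A\<close> is \<open>2 * (N * N) / d\<close>,
    and the cutoff \<open>12 * L ^ 2 * 2 ^ m\<close> meets its condition with equality.\<close>
  have "\<exists>T. is_tester \<epsilon> (small_balls N L) T \<and>
      max_queries_le T (8 * L ^ 2 * A + 12 * L ^ 2 * 2 ^ m * (L * (L * N)))"
    unfolding \<epsilon>_def
  proof (rule adaptive_tester_small_balls)
    show "d \<le> N * N" using NN L3 by (simp add: A_def)
    show "2 * (N * N) \<le> 8 * L ^ 2 * A * d" unfolding NN by simp
    have "12 * L ^ 2 * 2 ^ m * N = 24 * L ^ 3 * (2 ^ m * n)"
      by (simp add: N_def power2_eq_square power3_eq_cube)
    also have "\<dots> = 3 * (8 * L ^ 2 * A) * L" by (simp add: nA power2_eq_square power3_eq_cube)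
    finally show "3 * (8 * L ^ 2 * A) * L \<le> 12 * L ^ 2 * 2 ^ m * N" by (simp only: order_refl)
  qed (use N0 L3 d0 in auto)
  from Inf_enat_attained[of "\<lambda>k. \<exists>T. is_tester \<epsilon> (small_balls N L) T \<and> max_queries_le T k", OF this]
  obtain q T where q: "adaptive_qc \<epsilon> (small_balls N L) = enat q"
    "is_tester \<epsilon> (small_balls N L) T" "max_queries_le T q"
    "q \<le> 8 * L ^ 2 * A + 12 * L ^ 2 * 2 ^ m * (L * (L * N))"
    unfolding adaptive_qc_def by blast
  from Inf_enat_attained[of "\<lambda>k. \<exists>T. is_tester \<epsilon> (small_balls N L) T \<and> non_adaptive T \<and> max_queries_le T k",
      OF nonadaptive_tester_small_balls[OF eps0 N0]]
  obtain Q T' where Q: "nonadaptive_qc \<epsilon> (small_balls N L) = enat Q"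
    "is_tester \<epsilon> (small_balls N L) T'" "non_adaptive T'" "max_queries_le T' Q" "Q \<le> N * N"
    unfolding nonadaptive_qc_def by blast
  have "n ^ 2 \<le> 3 * (q * d)"
    using adaptive_lower_bound q(2,3) unfolding \<epsilon>_def N_def by blast
  then have "A \<le> 3 * q" using d0 unfolding n2 by simp
  moreover have "q \<le> 32 * L ^ 5 * A"
  proof -
    have "12 * L ^ 2 * 2 ^ m * (L * (L * N)) = 24 * L ^ 5 * (2 ^ m * n)"
      by (simp add: N_def power_numeral_reduce)
    moreover have "8 * L ^ 2 * A \<le> 8 * L ^ 5 * A"
      using L3 by (intro mult_right_mono mult_left_mono power_increasing) auto
    ultimately show ?thesis using q(4) unfolding nA by linarith
  qed
  moreover have "n ^ 2 \<le> 2 * Q"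
    using nonadaptive_lower_bound[OF _ _ _ LH big] Q(2-4) unfolding \<epsilon>_def N_def by blast
  moreover have "Q \<le> 4 * L ^ 2 * n ^ 2"
    using Q(5) unfolding n2 NN by (simp add: mult_ac)
  ultimately show ?thesis using q(1) Q(1) unfolding A_def by blast
qed

theorem theorem1:
  fixes t :: nat
  assumes "t \<ge> 8"
  shows "\<exists>c C :: real. \<exists>k :: nat. c > 0 \<and> C > 0 \<and>
    (\<forall>\<epsilon>0 > 0. \<exists>\<epsilon> :: real. 0 < \<epsilon> \<and> \<epsilon> < \<epsilon>0 \<and> \<epsilon> < 1/2 \<and>
       (\<exists>P q Q. graph_property P \<and>
          adaptive_qc \<epsilon> P = enat q \<and> nonadaptive_qc \<epsilon> P = enat Q \<and>
          c * (1/\<epsilon>) / ln (1/\<epsilon>) ^ k \<le> real q \<and>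
          real q \<le> C * (1/\<epsilon>) * ln (1/\<epsilon>) ^ k \<and>
          c * real q powr (2 - 2 / real t) / ln (1/\<epsilon>) ^ k \<le> real Q \<and>
          real Q \<le> C * real q powr (2 - 2 / real t) * ln (1/\<epsilon>) ^ k))"
proof -
  define C :: real where "C = 2048 * 12 ^ 10"
  have main: "\<exists>\<epsilon> :: real. 0 < \<epsilon> \<and> \<epsilon> < \<epsilon>0 \<and> \<epsilon> < 1/2 \<and>
       (\<exists>P q Q. graph_property P \<and>
          adaptive_qc \<epsilon> P = enat q \<and> nonadaptive_qc \<epsilon> P = enat Q \<and>
          1 / C * (1/\<epsilon>) / ln (1/\<epsilon>) ^ 10 \<le> real q \<and>
          real q \<le> C * (1/\<epsilon>) * ln (1/\<epsilon>) ^ 10 \<and>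
          1 / C * real q powr (2 - 2 / real t) / ln (1/\<epsilon>) ^ 10 \<le> real Q \<and>
          real Q \<le> C * real q powr (2 - 2 / real t) * ln (1/\<epsilon>) ^ 10)"
    if eps0: "0 < \<epsilon>0" for \<epsilon>0 :: real
  proof -
    \<comment> \<open>Since \<open>2 ^ m \<le> A \<le> 1 / \<epsilon>\<close> below, this forces
      \<open>\<epsilon>\<close> under both \<open>\<epsilon>0\<close> and 1/2.\<close>
    obtain m :: nat where m: "max (1 / \<epsilon>0) 2 < 2 ^ m" using real_arch_pow[of 2 "max (1 / \<epsilon>0) 2"] by auto
    have m1: "1 \<le> m" using m by (cases m) auto
    text \<open>The choices make \<open>1 / \<epsilon> = 4 * L ^ 2 * 2 ^ (m * t)\<close> and \<open>n ^ 2 = (2 ^ (m * t)) powr (2 - 2 / t)\<close>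
      with \<open>L\<close> logarithmic, so querying all pairs is already near-optimal non-adaptively.\<close>
    define L :: nat where "L = 2 * (m * (t - 1) + 2)"
    define n :: nat where "n = 2 ^ (m * (t - 1))"
    define d :: nat where "d = 2 ^ (m * (t - 2))"
    define N where "N = 2 * L * n"
    define \<epsilon> where "\<epsilon> = real d / real N ^ 2"
    define A :: real where "A = 2 ^ (m * t)"
    let ?e = "2 - 2 / real t"
    obtain q Q where qQ: "adaptive_qc \<epsilon> (small_balls N L) = enat q"
      "nonadaptive_qc \<epsilon> (small_balls N L) = enat Q"
      "2 ^ (m * t) \<le> 3 * q" "q \<le> 32 * L ^ 5 * 2 ^ (m * t)"
      "n ^ 2 \<le> 2 * Q" "Q \<le> 4 * L ^ 2 * n ^ 2"
      using query_complexity_small_balls[of m t] m1 assms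
      unfolding \<epsilon>_def N_def d_def n_def L_def by auto
    have d0: "0 < real d" and L1: "1 \<le> real L" by (simp_all add: d_def L_def)
    then have N0: "0 < real N" by (simp add: N_def n_def)
    have "m * (t - 1) + m * (t - 1) = m * (t - 2) + m * t"
      using assms by (simp add: algebra_simps diff_mult_distrib2)
    then have n2: "real n ^ 2 = real d * A"
      by (simp add: n_def d_def A_def power2_eq_square flip: power_add)
    have inv: "1 / \<epsilon> = 4 * real L ^ 2 * A"
    proof -
      have "1 / \<epsilon> = real N ^ 2 / real d" by (simp add: \<epsilon>_def)
      also have "real N ^ 2 = 4 * real L ^ 2 * A * real d"
        by (simp add: N_def power_mult_distrib n2)
      finally show ?thesis using d0 by simp
    qed
    have A_ge: "2 ^ m \<le> A" unfolding A_def using assms by (intro power_increasing) auto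
    have A1: "1 \<le> A" by (simp add: A_def)
    have "1 \<le> real L ^ 2" using L1 by (rule one_le_power)
    then have "1 * A \<le> (4 * real L ^ 2) * A" using A1 by (intro mult_right_mono) auto
    then have inv_ge: "A \<le> 1 / \<epsilon>" using inv by simp
    have eps: "0 < \<epsilon>" using d0 N0 by (simp add: \<epsilon>_def)
    have gt: "1 / \<epsilon>0 < 1 / \<epsilon>" "2 < 1 / \<epsilon>" using m A_ge inv_ge by linarith+
    have lnA: "ln A = real (m * t) * ln 2" by (simp add: A_def ln_realpow)
    have l_ge: "real (m * t) * ln 2 \<le> ln (1 / \<epsilon>)"
      unfolding lnA[symmetric] by (rule ln_mono) (use inv_ge A1 in linarith)+
    have ln2: "1 / 2 \<le> ln (2 :: real)" using ln2_ge_two_thirds by simp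
    have "real (m * t) * (1 / 2) \<le> real (m * t) * ln 2" using ln2 by (rule mult_left_mono) simp
    then have half: "real (m * t) \<le> 2 * ln (1 / \<epsilon>)" using l_ge by linarith
    have mt8: "8 \<le> m * t" using mult_le_mono[OF m1 assms] by simp
    then have "8 \<le> real (m * t)" using of_nat_mono[of 8 "m * t"] by simp
    then have l1: "1 \<le> ln (1 / \<epsilon>)" using half by linarith
    have "m * (t - 1) \<le> m * t" by simp
    moreover have "x \<le> y \<Longrightarrow> 8 \<le> y \<Longrightarrow> 2 * (x + 2) \<le> 6 * y" for x y :: nat by simp
    ultimately have "L \<le> 6 * (m * t)" using mt8 unfolding L_def by blast
    then have L12: "real L \<le> 12 * ln (1 / \<epsilon>)" using half by linarith
    have Ae: "A powr ?e = real n ^ 2"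
    proof -
      have "A = 2 powr real (m * t)" unfolding A_def by (rule powr_realpow[symmetric]) simp
      then have "A powr ?e = 2 powr (real (m * t) * ?e)" by (simp add: powr_powr)
      \<comment> \<open>The exponent of the theorem arises here, from
        \<open>t * (2 - 2 / t) = 2 * (t - 1)\<close>.\<close>
      also have "real (m * t) * ?e = real (m * (t - 1) * 2)"
        using assms by (simp add: field_simps of_nat_diff)
      also have "2 powr \<dots> = 2 ^ (m * (t - 1) * 2)" by (rule powr_realpow) simp
      also have "\<dots> = real n ^ 2" by (simp add: n_def power_mult)
      finally show ?thesis .
    qed
    have e: "0 \<le> ?e" "?e \<le> 2" using assms by (simp_all add: field_simps)
    have r: "A \<le> 3 * real q" "real q \<le> 32 * real L ^ 5 * A"
      "A powr ?e \<le> 2 * real Q" "real Q \<le> 4 * real L ^ 2 * A powr ?e"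
      using qQ(3-6)[THEN of_nat_mono[where 'a = real]] unfolding Ae unfolding A_def by simp_all
    note b = complexity_bounds[OF A1 L1 L12 l1 r(1,2) e r(3,4), folded C_def inv]
    show ?thesis
    proof (intro exI conjI)
      show "0 < \<epsilon>" by (rule eps)
      show "\<epsilon> < \<epsilon>0" using gt(1) eps eps0 by (simp add: field_simps)
      show "\<epsilon> < 1 / 2" using gt(2) eps by (simp add: field_simps)
      show "graph_property (small_balls N L)" by (rule graph_property_small_balls)
    qed (fact qQ(1,2) b)+
  qed
  show ?thesis
    by (intro exI[of _ "1 / C"] exI[of _ C] exI[of _ "10 :: nat"] conjI allI impI main)
       (simp_all add: C_def)
qed

end
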